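(* Let $p\in[2,997]$ be a prime, let $R=\mathbb{F}_p[X]$ and $\pi=X$. Let $B:=(R/\pi^3)(e\xrightarrow{a}f)/(\pi^2a)$. Then the Heller operator $\Omega:\underline{\mathrm{mod}}\text{-}B\to\underline{\mathrm{mod}}\text{-}B$ has a left adjoint.
   Context: $(R/\pi^3)(e\xrightarrow{a}f)$ is the path algebra over $R/\pi^3$ of the quiver with two vertices $e,f$ and one arrow $a:e\to f$, with $a\in eAf$ where $A$ denotes this algebra; $(\pi^2a)$ is the two-sided ideal generated by $\pi^2a$. $\mathrm{mod}\text{-}B$ is the category of finitely generated right $B$-modules; an object amounts to a morphism $g:X\to Y$ of finitely generated $R/\pi^3$-modules with $\pi^2g=0$. For a noetherian ring $B$, $\underline{\mathrm{mod}}\text{-}B$ is the factor category of $\mathrm{mod}\text{-}B$ modulo the full additive subcategory of projective modules (morphisms are identified if their difference factors over a projective module). The Heller operator $\Omega:\underline{\mathrm{mod}}\text{-}B\to\underline{\mathrm{mod}}\text{-}B$ is given on objects by choosing for each $X$ a short exact sequence $0\to\Omega X\to \mathrm{P}X\to X\to0$ with $\mathrm{P}X$ finitely generated projective; for $f:X\to Y$ one chooses a morphism $(f',\hat f,f)$ between the chosen sequences and sets $\Omega[f]:=[f']$. It is well defined up to isomorphism of functors. *)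

theory Defs
  imports
    "HOL-Algebra.QuotRing"
    "HOL-Algebra.UnivPoly"
    "HOL-Number_Theory.Residues"
    "Graph_Theory.Arc_Walk"
begin

section \<open>The algebra\<close>

text \<open>A quiver is a multi-digraph.  A path from \<open>u\<close> to \<open>v\<close> is a triple \<open>(u, p, v)\<close>, where \<open>p\<close> is the
  list of its arrows; for \<open>p = []\<close> this is the idempotent belonging to the vertex \<open>u = v\<close>.  Paths are
  composed from left to right, so that an arrow \<open>a : e \<rightarrow> f\<close> satisfies \<open>a = e a f\<close>.\<close>

type_synonym ('v, 'a) path = "'v \<times> 'a list \<times> 'v"

definition quiver_paths :: "('v, 'a) pre_digraph \<Rightarrow> ('v, 'a) path set" where
  "quiver_paths Q = {(u, p, v). pre_digraph.awalk Q u p v}"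

definition path_factorizations ::
    "('v, 'a) pre_digraph \<Rightarrow> ('v, 'a) path \<Rightarrow> (('v, 'a) path \<times> ('v, 'a) path) set" where
  "path_factorizations Q r =
     {((u, p, v), (v', q, w)) | u p v v' q w.
        (u, p, v) \<in> quiver_paths Q \<and> (v', q, w) \<in> quiver_paths Q \<and> v = v' \<and> r = (u, p @ q, w)}"

text \<open>Elements are the finitely supported coefficient families on the set of paths.  The unit element
  is the sum of the idempotents, so \<open>Q\<close> is meant to have finitely many vertices.\<close>

definition path_algebra ::
    "('s, 'k) ring_scheme \<Rightarrow> ('v, 'a) pre_digraph \<Rightarrow> (('v, 'a) path \<Rightarrow> 's) ring" where
  "path_algebra S Q =
     \<lparr>carrier = {x \<in> quiver_paths Q \<rightarrow>\<^sub>E carrier S. finite {r \<in> quiver_paths Q. x r \<noteq> \<zero>\<^bsub>S\<^esub>}},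
      monoid.mult = (\<lambda>x y. \<lambda>r\<in>quiver_paths Q.
         finsum S (\<lambda>(s, t). x s \<otimes>\<^bsub>S\<^esub> y t) (path_factorizations Q r)),
      monoid.one = (\<lambda>r\<in>quiver_paths Q. if fst (snd r) = [] then \<one>\<^bsub>S\<^esub> else \<zero>\<^bsub>S\<^esub>),
      ring.zero = (\<lambda>r\<in>quiver_paths Q. \<zero>\<^bsub>S\<^esub>),
      ring.add = (\<lambda>x y. \<lambda>r\<in>quiver_paths Q. x r \<oplus>\<^bsub>S\<^esub> y r)\<rparr>"

definition scaled_path ::
    "('s, 'k) ring_scheme \<Rightarrow> ('v, 'a) pre_digraph \<Rightarrow> 's \<Rightarrow> ('v, 'a) path \<Rightarrow> ('v, 'a) path \<Rightarrow> 's" where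
  "scaled_path S Q c s = (\<lambda>r\<in>quiver_paths Q. if r = s then c else \<zero>\<^bsub>S\<^esub>)"

datatype ef_vertex = Vertex_e | Vertex_f

datatype ef_arrow = Arrow_a

definition ef_quiver :: "(ef_vertex, ef_arrow) pre_digraph" where
  "ef_quiver =
     \<lparr>verts = {Vertex_e, Vertex_f}, arcs = {Arrow_a}, tail = (\<lambda>_. Vertex_e), head = (\<lambda>_. Vertex_f)\<rparr>"

definition poly_ring_Fp :: "nat \<Rightarrow> (int, nat \<Rightarrow> int) up_ring" where
  "poly_ring_Fp p = UP (residue_ring (int p))"

definition poly_X :: "nat \<Rightarrow> nat \<Rightarrow> int" where
  "poly_X p = up_ring.monom (poly_ring_Fp p) \<one>\<^bsub>residue_ring (int p)\<^esub> 1"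

definition ideal_X_cubed :: "nat \<Rightarrow> (nat \<Rightarrow> int) set" where
  "ideal_X_cubed p = Idl\<^bsub>poly_ring_Fp p\<^esub> {poly_X p [^]\<^bsub>poly_ring_Fp p\<^esub> (3::nat)}"

definition base_ring :: "nat \<Rightarrow> (nat \<Rightarrow> int) set ring" where
  "base_ring p = poly_ring_Fp p Quot ideal_X_cubed p"

text \<open>The residue class of \<open>\<pi> = X\<close> modulo \<open>\<pi>\<^sup>3\<close>.\<close>

definition base_pi :: "nat \<Rightarrow> (nat \<Rightarrow> int) set" where
  "base_pi p = ideal_X_cubed p +>\<^bsub>poly_ring_Fp p\<^esub> poly_X p"

type_synonym ef_path_coeffs = "(ef_vertex, ef_arrow) path \<Rightarrow> (nat \<Rightarrow> int) set"

definition ef_path_algebra :: "nat \<Rightarrow> ef_path_coeffs ring" where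
  "ef_path_algebra p = path_algebra (base_ring p) ef_quiver"

definition pi_squared_a :: "nat \<Rightarrow> ef_path_coeffs" where
  "pi_squared_a p =
     scaled_path (base_ring p) ef_quiver (base_pi p [^]\<^bsub>base_ring p\<^esub> (2::nat))
       (Vertex_e, [Arrow_a], Vertex_f)"

definition algebra_B :: "nat \<Rightarrow> ef_path_coeffs set ring" where
  "algebra_B p = ef_path_algebra p Quot (Idl\<^bsub>ef_path_algebra p\<^esub> {pi_squared_a p})"


section \<open>Finitely generated right modules\<close>

text \<open>As for the left modules of \<^theory>\<open>HOL-Algebra.Module\<close>, the multiplicative part of the
  underlying ring record of a module is irrelevant.\<close>

record ('b, 'm) right_mod = "'m ring" +
  ract :: "'m \<Rightarrow> 'b \<Rightarrow> 'm" (infixl \<open>\<star>\<index>\<close> 70)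

locale right_module = B?: ring B + M?: abelian_group M
  for B :: "('b, 'k) ring_scheme" (structure) and M :: "('b, 'm, 'l) right_mod_scheme" (structure) +
  assumes ract_closed: "\<lbrakk>x \<in> carrier M; b \<in> carrier B\<rbrakk> \<Longrightarrow> x \<star>\<^bsub>M\<^esub> b \<in> carrier M"
    and ract_add_left: "\<lbrakk>x \<in> carrier M; y \<in> carrier M; b \<in> carrier B\<rbrakk> \<Longrightarrow>
      (x \<oplus>\<^bsub>M\<^esub> y) \<star>\<^bsub>M\<^esub> b = x \<star>\<^bsub>M\<^esub> b \<oplus>\<^bsub>M\<^esub> y \<star>\<^bsub>M\<^esub> b"
    and ract_add_right: "\<lbrakk>x \<in> carrier M; b \<in> carrier B; c \<in> carrier B\<rbrakk> \<Longrightarrow>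
      x \<star>\<^bsub>M\<^esub> (b \<oplus>\<^bsub>B\<^esub> c) = x \<star>\<^bsub>M\<^esub> b \<oplus>\<^bsub>M\<^esub> x \<star>\<^bsub>M\<^esub> c"
    and ract_mult: "\<lbrakk>x \<in> carrier M; b \<in> carrier B; c \<in> carrier B\<rbrakk> \<Longrightarrow>
      x \<star>\<^bsub>M\<^esub> (b \<otimes>\<^bsub>B\<^esub> c) = (x \<star>\<^bsub>M\<^esub> b) \<star>\<^bsub>M\<^esub> c"
    and ract_one: "x \<in> carrier M \<Longrightarrow> x \<star>\<^bsub>M\<^esub> \<one>\<^bsub>B\<^esub> = x"

definition right_submodule :: "('b, 'k) ring_scheme \<Rightarrow> ('b, 'm) right_mod \<Rightarrow> 'm set \<Rightarrow> bool" where
  "right_submodule B M N \<longleftrightarrow>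
     subgroup N (add_monoid M) \<and> (\<forall>x\<in>N. \<forall>b\<in>carrier B. x \<star>\<^bsub>M\<^esub> b \<in> N)"

definition fin_gen :: "('b, 'k) ring_scheme \<Rightarrow> ('b, 'm) right_mod \<Rightarrow> bool" where
  "fin_gen B M \<longleftrightarrow>
     (\<exists>G. finite G \<and> G \<subseteq> carrier M \<and> (\<forall>N. right_submodule B M N \<and> G \<subseteq> N \<longrightarrow> N = carrier M))"

text \<open>The objects of \<open>mod-B\<close> have their elements in the type \<open>'m\<close>.  If \<open>B\<close> is finite, then so is every
  finitely generated module, hence for infinite \<open>'m\<close> every finitely generated module is isomorphic to
  one of these.\<close>

definition fg_modules :: "('b, 'k) ring_scheme \<Rightarrow> ('b, 'm) right_mod set" where
  "fg_modules B = {M. right_module B M \<and> fin_gen B M}"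

definition rmod_hom ::
    "('b, 'k) ring_scheme \<Rightarrow> ('b, 'm) right_mod \<Rightarrow> ('b, 'n) right_mod \<Rightarrow> ('m \<Rightarrow> 'n) set" where
  "rmod_hom B M N =
     {h \<in> carrier M \<rightarrow>\<^sub>E carrier N.
        (\<forall>x\<in>carrier M. \<forall>y\<in>carrier M. h (x \<oplus>\<^bsub>M\<^esub> y) = h x \<oplus>\<^bsub>N\<^esub> h y) \<and>
        (\<forall>x\<in>carrier M. \<forall>b\<in>carrier B. h (x \<star>\<^bsub>M\<^esub> b) = h x \<star>\<^bsub>N\<^esub> b)}"

text \<open>The lifting property is required for all right modules with elements in \<open>'m\<close>, whether or not
  they are finitely generated.  If \<open>B\<close> is finite and \<open>'m\<close> is infinite, every finitely generated
  \<open>P\<close> is the image of a module in \<open>'m\<close> isomorphic to some \<open>B\<^sup>n\<close>, so that this is projectivity in the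
  usual sense.\<close>

definition projective :: "('b, 'k) ring_scheme \<Rightarrow> ('b, 'm) right_mod \<Rightarrow> bool" where
  "projective B P \<longleftrightarrow>
     right_module B P \<and>
     (\<forall>(M :: ('b, 'm) right_mod) (N :: ('b, 'm) right_mod) g h.
        right_module B M \<and> right_module B N \<and>
        g \<in> rmod_hom B M N \<and> g ` carrier M = carrier N \<and> h \<in> rmod_hom B P N \<longrightarrow>
        (\<exists>k\<in>rmod_hom B P M. compose (carrier P) g k = h))"

definition short_exact ::
    "('b, 'k) ring_scheme \<Rightarrow> ('b, 'm) right_mod \<Rightarrow> ('b, 'm) right_mod \<Rightarrow> ('b, 'm) right_mod \<Rightarrow>
     ('m \<Rightarrow> 'm) \<Rightarrow> ('m \<Rightarrow> 'm) \<Rightarrow> bool" where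
  "short_exact B K P X i q \<longleftrightarrow>
     i \<in> rmod_hom B K P \<and> q \<in> rmod_hom B P X \<and> inj_on i (carrier K) \<and>
     i ` carrier K = {x \<in> carrier P. q x = \<zero>\<^bsub>X\<^esub>} \<and> q ` carrier P = carrier X"


section \<open>Categories and adjoint functors\<close>

text \<open>The morphism sets need not be disjoint, so composition carries source, middle and target:
  \<open>Comp C X Y Z g f\<close> is \<open>g \<circ> f\<close> for \<open>f : X \<rightarrow> Y\<close> and \<open>g : Y \<rightarrow> Z\<close>.\<close>

record ('o, 'f) cat =
  Obj :: "'o set"
  Hom :: "'o \<Rightarrow> 'o \<Rightarrow> 'f set"
  Comp :: "'o \<Rightarrow> 'o \<Rightarrow> 'o \<Rightarrow> 'f \<Rightarrow> 'f \<Rightarrow> 'f"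
  Ident :: "'o \<Rightarrow> 'f"

record ('o, 'f, 'p, 'g) functor_data =
  on_obj :: "'o \<Rightarrow> 'p"
  on_hom :: "'o \<Rightarrow> 'o \<Rightarrow> 'f \<Rightarrow> 'g"

definition is_functor ::
    "('o, 'f) cat \<Rightarrow> ('p, 'g) cat \<Rightarrow> ('o, 'f, 'p, 'g) functor_data \<Rightarrow> bool" where
  "is_functor C D F \<longleftrightarrow>
     (\<forall>X\<in>Obj C. on_obj F X \<in> Obj D) \<and>
     (\<forall>X\<in>Obj C. \<forall>Y\<in>Obj C. \<forall>f\<in>Hom C X Y.
        on_hom F X Y f \<in> Hom D (on_obj F X) (on_obj F Y)) \<and>
     (\<forall>X\<in>Obj C. on_hom F X X (Ident C X) = Ident D (on_obj F X)) \<and>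
     (\<forall>X\<in>Obj C. \<forall>Y\<in>Obj C. \<forall>Z\<in>Obj C. \<forall>f\<in>Hom C X Y. \<forall>g\<in>Hom C Y Z.
        on_hom F X Z (Comp C X Y Z g f) =
          Comp D (on_obj F X) (on_obj F Y) (on_obj F Z) (on_hom F Y Z g) (on_hom F X Y f))"

text \<open>\<open>L\<close> is left adjoint to \<open>G\<close>: there is a bijection between morphisms \<open>L X \<rightarrow> Y\<close> and morphisms
  \<open>X \<rightarrow> G Y\<close>, natural in \<open>X\<close> and in \<open>Y\<close>.\<close>

definition left_adjoint ::
    "('o, 'f) cat \<Rightarrow> ('p, 'g) cat \<Rightarrow> ('p, 'g, 'o, 'f) functor_data \<Rightarrow> ('o, 'f, 'p, 'g) functor_data
     \<Rightarrow> bool" where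
  "left_adjoint C D L G \<longleftrightarrow>
     is_functor D C L \<and> is_functor C D G \<and>
     (\<exists>\<phi>.
        (\<forall>X\<in>Obj D. \<forall>Y\<in>Obj C. bij_betw (\<phi> X Y) (Hom C (on_obj L X) Y) (Hom D X (on_obj G Y))) \<and>
        (\<forall>X\<in>Obj D. \<forall>Y\<in>Obj C. \<forall>Y'\<in>Obj C. \<forall>u\<in>Hom C (on_obj L X) Y. \<forall>g\<in>Hom C Y Y'.
           \<phi> X Y' (Comp C (on_obj L X) Y Y' g u) =
             Comp D X (on_obj G Y) (on_obj G Y') (on_hom G Y Y' g) (\<phi> X Y u)) \<and>
        (\<forall>X\<in>Obj D. \<forall>X'\<in>Obj D. \<forall>Y\<in>Obj C. \<forall>u\<in>Hom C (on_obj L X) Y. \<forall>f\<in>Hom D X' X.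
           \<phi> X' Y (Comp C (on_obj L X') (on_obj L X) Y u (on_hom L X' X f)) =
             Comp D X' X (on_obj G Y) (\<phi> X Y u) f))"

definition has_left_adjoint ::
    "('o, 'f) cat \<Rightarrow> ('p, 'g) cat \<Rightarrow> ('o, 'f, 'p, 'g) functor_data \<Rightarrow> bool" where
  "has_left_adjoint C D G \<longleftrightarrow> (\<exists>L. left_adjoint C D L G)"


section \<open>The stable category and the Heller operator\<close>

definition stable_rel ::
    "('b, 'k) ring_scheme \<Rightarrow> ('b, 'm) right_mod \<Rightarrow> ('b, 'm) right_mod \<Rightarrow>
     (('m \<Rightarrow> 'm) \<times> ('m \<Rightarrow> 'm)) set" where
  "stable_rel B X Y =
     {(f, g). f \<in> rmod_hom B X Y \<and> g \<in> rmod_hom B X Y \<and>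
        (\<exists>(P :: ('b, 'm) right_mod) u v. P \<in> fg_modules B \<and> projective B P \<and>
           u \<in> rmod_hom B X P \<and> v \<in> rmod_hom B P Y \<and>
           (\<forall>x\<in>carrier X. f x \<ominus>\<^bsub>Y\<^esub> g x = v (u x)))}"

definition stable_class ::
    "('b, 'k) ring_scheme \<Rightarrow> ('b, 'm) right_mod \<Rightarrow> ('b, 'm) right_mod \<Rightarrow>
     ('m \<Rightarrow> 'm) \<Rightarrow> ('m \<Rightarrow> 'm) set" where
  "stable_class B X Y f = stable_rel B X Y `` {f}"

text \<open>The union in the composition is over representatives; all of them give the same class.\<close>

definition stable_mod ::
    "('b, 'k) ring_scheme \<Rightarrow> (('b, 'm) right_mod, ('m \<Rightarrow> 'm) set) cat" where
  "stable_mod B =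
     \<lparr>Obj = fg_modules B,
      Hom = (\<lambda>X Y. rmod_hom B X Y // stable_rel B X Y),
      Comp = (\<lambda>X Y Z \<beta> \<alpha>. \<Union>g\<in>\<beta>. \<Union>f\<in>\<alpha>. stable_class B X Z (compose (carrier X) g f)),
      Ident = (\<lambda>X. stable_class B X X (\<lambda>x\<in>carrier X. x))\<rparr>"

type_synonym ('b, 'm) stable_endo =
  "(('b, 'm) right_mod, ('m \<Rightarrow> 'm) set, ('b, 'm) right_mod, ('m \<Rightarrow> 'm) set) functor_data"

text \<open>\<open>\<Omega>\<close> is the Heller operator belonging to some choice of short exact sequences
  \<open>0 \<rightarrow> \<Omega> X \<rightarrow> P X \<rightarrow> X \<rightarrow> 0\<close> and of morphisms \<open>(f', f\<^sub>0, f)\<close> between these.\<close>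

definition heller_operator ::
    "('b, 'k) ring_scheme \<Rightarrow> ('b, 'm) stable_endo \<Rightarrow> bool" where
  "heller_operator B \<Omega> \<longleftrightarrow>
     (\<exists>P i q.
        (\<forall>X\<in>fg_modules B.
           on_obj \<Omega> X \<in> fg_modules B \<and> P X \<in> fg_modules B \<and> projective B (P X) \<and>
           short_exact B (on_obj \<Omega> X) (P X) X (i X) (q X)) \<and>
        (\<forall>X\<in>fg_modules B. \<forall>Y\<in>fg_modules B. \<forall>f\<in>rmod_hom B X Y.
           \<exists>f'\<in>rmod_hom B (on_obj \<Omega> X) (on_obj \<Omega> Y). \<exists>f\<^sub>0\<in>rmod_hom B (P X) (P Y).
             compose (carrier (on_obj \<Omega> X)) (i Y) f' = compose (carrier (on_obj \<Omega> X)) f\<^sub>0 (i X) \<and>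
             compose (carrier (P X)) (q Y) f\<^sub>0 = compose (carrier (P X)) f (q X) \<and>
             on_hom \<Omega> X Y (stable_class B X Y f) =
               stable_class B (on_obj \<Omega> X) (on_obj \<Omega> Y) f'))"

end

theory Submission
  imports Defs
begin

text \<open>Over any finite ring, the left adjoint of \<open>\<Omega>\<close> sends \<open>X\<close> to the cokernel \<open>C\<close> of a left approximation
  \<open>\<iota> : X \<rightarrow> A\<close> by a finitely generated projective module, i.e. a map through which every map from \<open>X\<close> to
  such a module factors.  A map \<open>X \<rightarrow> \<Omega> Y\<close>, followed by \<open>\<Omega> Y \<rightarrow> P Y\<close>, extends along \<open>\<iota>\<close> to \<open>A \<rightarrow> P Y\<close> and hence
  induces \<open>C \<rightarrow> Y\<close>; conversely \<open>C \<rightarrow> Y\<close> lifts to \<open>A \<rightarrow> P Y\<close>, which restricts to \<open>X \<rightarrow> \<Omega> Y\<close>.  Both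
  constructions are well defined up to maps that factor over projectives, and they are mutually inverse.
  Only the finiteness of the algebra \<open>B\<close> enters.\<close>

section \<open>Left adjoints from universal arrows\<close>

text \<open>Nothing forces \<iota> to be injective, so the short exact sequences behind \<Omega>
  have no mirror image here: only X -> A -> C -> 0 is exact. This is enough, because a map to
  \<open>P Y\<close> that kills the image of \<iota> descends to C, and because A, being projective,
  lifts the projection A -> C along P C -> C. Extensions along \<iota> are not unique either, so a
  morphism X' -> X gives no preferred morphism of cokernels. Therefore each X is treated separately:
  C comes with one morphism \<eta> : X -> \<Omega> C that represents the functor Hom(X, \<Omega> -),
  and the action of the adjoint on morphisms is then forced. Another obstacle is that all objects
  have their elements in one prescribed type, whereas free modules consist of functions and
  quotients of cosets. Finite modules can be copied into any infinite type, and cosets can be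
  replaced by chosen members. Together with the finiteness of the set of linear forms on X, this is
  where the finiteness of B is spent.\<close>

definition is_category :: "('o, 'f) cat \<Rightarrow> bool" where
  "is_category C \<longleftrightarrow>
     (\<forall>X\<in>Obj C. Ident C X \<in> Hom C X X) \<and>
     (\<forall>X\<in>Obj C. \<forall>Y\<in>Obj C. \<forall>f\<in>Hom C X Y.
        Comp C X X Y f (Ident C X) = f \<and> Comp C X Y Y (Ident C Y) f = f) \<and>
     (\<forall>X\<in>Obj C. \<forall>Y\<in>Obj C. \<forall>Z\<in>Obj C. \<forall>f\<in>Hom C X Y. \<forall>g\<in>Hom C Y Z. Comp C X Y Z g f \<in> Hom C X Z) \<and>
     (\<forall>X\<in>Obj C. \<forall>Y\<in>Obj C. \<forall>Z\<in>Obj C. \<forall>W\<in>Obj C. \<forall>f\<in>Hom C X Y. \<forall>g\<in>Hom C Y Z. \<forall>h\<in>Hom C Z W.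
        Comp C X Y W (Comp C Y Z W h g) f = Comp C X Z W h (Comp C X Y Z g f))"

text \<open>If every functor Hom(X, G -) is represented by a pair \<open>L X\<close>,
  \<open>\<eta> X\<close>, the morphism part of the left adjoint needs no construction of its own.
  The record \<open>cat\<close> stores bare data, so the category laws enter as hypotheses.\<close>

lemma has_left_adjoint_universal_arrows:
  fixes C :: "('o, 'f) cat" and D :: "('p, 'g) cat"
  assumes C: "is_category C" and D: "is_category D" and G: "is_functor C D G"
    and L: "\<And>X. X \<in> Obj D \<Longrightarrow> L X \<in> Obj C"
    and eta: "\<And>X. X \<in> Obj D \<Longrightarrow> \<eta> X \<in> Hom D X (on_obj G (L X))"
    and bij: "\<And>X Y. X \<in> Obj D \<Longrightarrow> Y \<in> Obj C \<Longrightarrow>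
      bij_betw (\<lambda>u. Comp D X (on_obj G (L X)) (on_obj G Y) (on_hom G (L X) Y u) (\<eta> X))
        (Hom C (L X) Y) (Hom D X (on_obj G Y))"
  shows "has_left_adjoint C D G"
proof -
  define \<phi> where "\<phi> X Y u = Comp D X (on_obj G (L X)) (on_obj G Y) (on_hom G (L X) Y u) (\<eta> X)"
    for X Y u
  have \<phi>_bij: "bij_betw (\<phi> X Y) (Hom C (L X) Y) (Hom D X (on_obj G Y))"
    if "X \<in> Obj D" "Y \<in> Obj C" for X Y
    using bij[OF that] by (simp add: \<phi>_def[abs_def])
  have C_id: "Ident C X \<in> Hom C X X" if "X \<in> Obj C" for X
    using C that by (simp add: is_category_def)
  have C_comp: "Comp C X Y Z g f \<in> Hom C X Z"
    if "f \<in> Hom C X Y" "g \<in> Hom C Y Z" "X \<in> Obj C" "Y \<in> Obj C" "Z \<in> Obj C" for X Y Z f g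
    using C that by (simp add: is_category_def)
  have D_comp: "Comp D X Y Z g f \<in> Hom D X Z"
    if "f \<in> Hom D X Y" "g \<in> Hom D Y Z" "X \<in> Obj D" "Y \<in> Obj D" "Z \<in> Obj D" for X Y Z f g
    using D that by (simp add: is_category_def)
  have D_assoc: "Comp D X Y W (Comp D Y Z W h g) f = Comp D X Z W h (Comp D X Y Z g f)"
    if "f \<in> Hom D X Y" "g \<in> Hom D Y Z" "h \<in> Hom D Z W"
      "X \<in> Obj D" "Y \<in> Obj D" "Z \<in> Obj D" "W \<in> Obj D" for X Y Z W f g h
    using D that unfolding is_category_def by blast
  have D_id: "Comp D X X Y f (Ident D X) = f" "Comp D X Y Y (Ident D Y) f = f"
    if "f \<in> Hom D X Y" "X \<in> Obj D" "Y \<in> Obj D" for X Y f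
    using D that by (simp_all add: is_category_def)
  have D_ident: "Ident D X \<in> Hom D X X" if "X \<in> Obj D" for X
    using D that by (simp add: is_category_def)
  have G_obj: "on_obj G X \<in> Obj D" if "X \<in> Obj C" for X
    using G that by (simp add: is_functor_def)
  have G_hom: "on_hom G X Y f \<in> Hom D (on_obj G X) (on_obj G Y)"
    if "f \<in> Hom C X Y" "X \<in> Obj C" "Y \<in> Obj C" for X Y f
    using G that by (simp add: is_functor_def)
  have G_comp: "on_hom G X Z (Comp C X Y Z g f) =
      Comp D (on_obj G X) (on_obj G Y) (on_obj G Z) (on_hom G Y Z g) (on_hom G X Y f)"
    if "f \<in> Hom C X Y" "g \<in> Hom C Y Z" "X \<in> Obj C" "Y \<in> Obj C" "Z \<in> Obj C" for X Y Z f g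
    using G that by (simp add: is_functor_def)
  have G_id: "on_hom G X X (Ident C X) = Ident D (on_obj G X)" if "X \<in> Obj C" for X
    using G that by (simp add: is_functor_def)
  have nat_Y: "\<phi> X Y' (Comp C (L X) Y Y' g u) =
      Comp D X (on_obj G Y) (on_obj G Y') (on_hom G Y Y' g) (\<phi> X Y u)"
    if "X \<in> Obj D" "Y \<in> Obj C" "Y' \<in> Obj C" "u \<in> Hom C (L X) Y" "g \<in> Hom C Y Y'" for X Y Y' u g
    using that by (simp add: \<phi>_def G_comp D_assoc G_hom G_obj L eta)
  \<comment> \<open>The only candidate: naturality of \<open>\<eta>\<close> demands that
    \<open>l X' X f\<close> correspond to \<open>\<eta> X\<close> composed with
    \<open>f\<close>.\<close>
  define l where "l X' X f =
      inv_into (Hom C (L X') (L X)) (\<phi> X' (L X)) (Comp D X' X (on_obj G (L X)) (\<eta> X) f)" for X' X f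
  have l: "l X' X f \<in> Hom C (L X') (L X)"
      "\<phi> X' (L X) (l X' X f) = Comp D X' X (on_obj G (L X)) (\<eta> X) f"
    if "X' \<in> Obj D" "X \<in> Obj D" "f \<in> Hom D X' X" for X' X f
  proof -
    have "Comp D X' X (on_obj G (L X)) (\<eta> X) f \<in> Hom D X' (on_obj G (L X))"
      using that by (intro D_comp) (auto simp: eta L G_obj)
    then have im: "Comp D X' X (on_obj G (L X)) (\<eta> X) f \<in> \<phi> X' (L X) ` Hom C (L X') (L X)"
      using bij_betw_imp_surj_on[OF \<phi>_bij[of X' "L X"]] that L by simp
    show "l X' X f \<in> Hom C (L X') (L X)"
      "\<phi> X' (L X) (l X' X f) = Comp D X' X (on_obj G (L X)) (\<eta> X) f"
      using inv_into_into[OF im] f_inv_into_f[OF im] by (simp_all add: l_def)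
  qed
  have nat_X: "\<phi> X' Y (Comp C (L X') (L X) Y u (l X' X f)) = Comp D X' X (on_obj G Y) (\<phi> X Y u) f"
    if "X \<in> Obj D" "X' \<in> Obj D" "Y \<in> Obj C" "u \<in> Hom C (L X) Y" "f \<in> Hom D X' X" for X X' Y u f
  proof -
    have "\<phi> X' Y (Comp C (L X') (L X) Y u (l X' X f)) =
        Comp D X' (on_obj G (L X)) (on_obj G Y) (on_hom G (L X) Y u)
          (Comp D X' X (on_obj G (L X)) (\<eta> X) f)"
      using that by (simp add: nat_Y l L)
    also have "\<dots> = Comp D X' X (on_obj G Y) (\<phi> X Y u) f"
      unfolding \<phi>_def using that by (subst D_assoc) (auto simp: eta G_hom L G_obj)
    finally show ?thesis .
  qed
  define F where "F = \<lparr>on_obj = L, on_hom = l\<rparr>"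
  \<comment> \<open>Morphisms out of \<open>L X\<close> are compared through their images under
    \<open>\<phi>\<close>; both functor laws for \<open>l\<close> are obtained this way.\<close>
  have inj: "u = v"
    if "\<phi> X Y u = \<phi> X Y v" "X \<in> Obj D" "Y \<in> Obj C" "u \<in> Hom C (L X) Y" "v \<in> Hom C (L X) Y" for X Y u v
    using \<phi>_bij[of X Y] that by (auto simp: bij_betw_def dest: inj_onD)
  have l_id: "l X X (Ident D X) = Ident C (L X)" if X: "X \<in> Obj D" for X
  proof (rule inj[OF _ X L[OF X]])
    have "\<phi> X (L X) (Ident C (L X)) = \<eta> X"
      using X D_id(2)[OF eta[OF X] X G_obj[OF L[OF X]]] by (simp add: \<phi>_def G_id L)
    then show "\<phi> X (L X) (l X X (Ident D X)) = \<phi> X (L X) (Ident C (L X))"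
      using X by (simp add: l D_ident D_id(1)[OF eta] L G_obj)
  qed (auto simp: X l D_ident C_id L)
  have l_comp: "l X Z (Comp D X Y Z g f) = Comp C (L X) (L Y) (L Z) (l Y Z g) (l X Y f)"
    if o: "X \<in> Obj D" "Y \<in> Obj D" "Z \<in> Obj D" "f \<in> Hom D X Y" "g \<in> Hom D Y Z" for X Y Z f g
  proof (rule inj[of X "L Z"])
    show "\<phi> X (L Z) (l X Z (Comp D X Y Z g f)) =
        \<phi> X (L Z) (Comp C (L X) (L Y) (L Z) (l Y Z g) (l X Y f))"
      using o by (subst nat_X) (auto simp: l D_comp L D_assoc eta G_obj)
  qed (use o in \<open>auto intro!: l D_comp C_comp L\<close>)
  have "left_adjoint C D F G"
    unfolding left_adjoint_def
  proof (intro conjI exI[of _ \<phi>])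
    show "is_functor D C F"
      by (auto simp: is_functor_def F_def L l l_id l_comp)
  qed (auto simp: F_def G \<phi>_bij nat_Y nat_X)
  then show ?thesis by (auto simp: has_left_adjoint_def)
qed

section \<open>Module homomorphisms\<close>

lemma (in abelian_group) minus_eq_zero_iff:
  assumes "x \<in> carrier G" "y \<in> carrier G"
  shows "x \<ominus> y = \<zero> \<longleftrightarrow> x = y"
  using assms by (metis a_inv_closed a_minus_def minus_equality minus_minus r_neg)

section \<open>Arithmetic of the right action\<close>

context right_module
begin

lemma ract_zero_left:
  assumes "b \<in> carrier B"
  shows "\<zero>\<^bsub>M\<^esub> \<star>\<^bsub>M\<^esub> b = \<zero>\<^bsub>M\<^esub>"
proof -
  have "\<zero>\<^bsub>M\<^esub> \<star>\<^bsub>M\<^esub> b \<oplus>\<^bsub>M\<^esub> \<zero>\<^bsub>M\<^esub> \<star>\<^bsub>M\<^esub> b = \<zero>\<^bsub>M\<^esub> \<star>\<^bsub>M\<^esub> b"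
    using ract_add_left[of "\<zero>\<^bsub>M\<^esub>" "\<zero>\<^bsub>M\<^esub>" b] assms by simp
  then show ?thesis
    using assms by (metis M.add.l_cancel_one' M.zero_closed ract_closed)
qed

lemma ract_zero_right:
  assumes "x \<in> carrier M"
  shows "x \<star>\<^bsub>M\<^esub> \<zero>\<^bsub>B\<^esub> = \<zero>\<^bsub>M\<^esub>"
proof -
  have "x \<star>\<^bsub>M\<^esub> \<zero>\<^bsub>B\<^esub> \<oplus>\<^bsub>M\<^esub> x \<star>\<^bsub>M\<^esub> \<zero>\<^bsub>B\<^esub> = x \<star>\<^bsub>M\<^esub> \<zero>\<^bsub>B\<^esub>"
    using ract_add_right[of x "\<zero>\<^bsub>B\<^esub>" "\<zero>\<^bsub>B\<^esub>"] assms by simp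
  then show ?thesis
    using assms by (metis M.add.l_cancel_one' B.zero_closed ract_closed)
qed

lemma ract_minus_left:
  assumes "x \<in> carrier M" "b \<in> carrier B"
  shows "(\<ominus>\<^bsub>M\<^esub> x) \<star>\<^bsub>M\<^esub> b = \<ominus>\<^bsub>M\<^esub> (x \<star>\<^bsub>M\<^esub> b)"
  by (metis M.add.inv_closed M.l_neg M.minus_equality assms ract_add_left ract_closed ract_zero_left)

lemma ract_finsum:
  assumes "f \<in> A \<rightarrow> carrier M" "b \<in> carrier B"
  shows "finsum M f A \<star>\<^bsub>M\<^esub> b = finsum M (\<lambda>i. f i \<star>\<^bsub>M\<^esub> b) A"
  using assms
  by (induction A rule: infinite_finite_induct)
    (auto simp: ract_zero_left ract_add_left ract_closed Pi_def)

end

section \<open>Homomorphisms and pointwise operations on them\<close>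

lemma rmod_hom_closed: "h \<in> rmod_hom B M N \<Longrightarrow> x \<in> carrier M \<Longrightarrow> h x \<in> carrier N"
  by (auto simp: rmod_hom_def)

lemma rmod_hom_add:
  "h \<in> rmod_hom B M N \<Longrightarrow> x \<in> carrier M \<Longrightarrow> y \<in> carrier M \<Longrightarrow> h (x \<oplus>\<^bsub>M\<^esub> y) = h x \<oplus>\<^bsub>N\<^esub> h y"
  by (simp add: rmod_hom_def)

lemma rmod_hom_ract:
  "h \<in> rmod_hom B M N \<Longrightarrow> x \<in> carrier M \<Longrightarrow> b \<in> carrier B \<Longrightarrow> h (x \<star>\<^bsub>M\<^esub> b) = h x \<star>\<^bsub>N\<^esub> b"
  by (simp add: rmod_hom_def)

lemma rmod_hom_eqI:
  "f \<in> rmod_hom B M N \<Longrightarrow> g \<in> rmod_hom B M N \<Longrightarrow> (\<And>x. x \<in> carrier M \<Longrightarrow> f x = g x) \<Longrightarrow> f = g"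
  unfolding rmod_hom_def by (auto intro: extensionalityI[of _ "carrier M"] simp: PiE_def)

lemma rmod_hom_restrictI:
  assumes "right_module B M"
    and "\<And>x. x \<in> carrier M \<Longrightarrow> h x \<in> carrier N"
    and "\<And>x y. x \<in> carrier M \<Longrightarrow> y \<in> carrier M \<Longrightarrow> h (x \<oplus>\<^bsub>M\<^esub> y) = h x \<oplus>\<^bsub>N\<^esub> h y"
    and "\<And>x b. x \<in> carrier M \<Longrightarrow> b \<in> carrier B \<Longrightarrow> h (x \<star>\<^bsub>M\<^esub> b) = h x \<star>\<^bsub>N\<^esub> b"
  shows "(\<lambda>x\<in>carrier M. h x) \<in> rmod_hom B M N"
proof -
  interpret right_module B M by fact
  show ?thesis using assms(2-) by (auto simp: rmod_hom_def ract_closed)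
qed

lemma rmod_hom_abelian_group_hom:
  assumes "right_module B M" "right_module B N" "h \<in> rmod_hom B M N"
  shows "abelian_group_hom M N h"
proof -
  interpret M: right_module B M by fact
  interpret N: right_module B N by fact
  show ?thesis
    by (intro abelian_group_homI M.M.abelian_group_axioms N.M.abelian_group_axioms group_hom.intro
        M.M.a_group N.M.a_group group_hom_axioms.intro homI)
      (auto simp: rmod_hom_closed[OF assms(3)] rmod_hom_add[OF assms(3)])
qed

lemma rmod_hom_zero:
  assumes "right_module B M" "right_module B N" "h \<in> rmod_hom B M N"
  shows "h \<zero>\<^bsub>M\<^esub> = \<zero>\<^bsub>N\<^esub>"
  using abelian_group_hom.hom_zero[OF rmod_hom_abelian_group_hom[OF assms]] .

lemma rmod_hom_diff:
  assumes "right_module B M" "right_module B N" "h \<in> rmod_hom B M N" "x \<in> carrier M" "y \<in> carrier M"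
  shows "h (x \<ominus>\<^bsub>M\<^esub> y) = h x \<ominus>\<^bsub>N\<^esub> h y"
proof -
  interpret M: right_module B M by fact
  interpret N: right_module B N by fact
  show ?thesis
    using assms abelian_group_hom.hom_a_inv[OF rmod_hom_abelian_group_hom[OF assms(1-3)], of y]
    by (simp add: a_minus_def rmod_hom_add[OF assms(3)])
qed

lemma rmod_hom_finsum:
  assumes "right_module B M" "right_module B N" "h \<in> rmod_hom B M N" "f \<in> A \<rightarrow> carrier M"
  shows "h (finsum M f A) = finsum N (\<lambda>i. h (f i)) A"
proof -
  interpret M: right_module B M by fact
  interpret N: right_module B N by fact
  show ?thesis using assms(4)
    by (induction A rule: infinite_finite_induct)
      (auto simp: rmod_hom_zero[OF assms(1-3)] rmod_hom_add[OF assms(3)] rmod_hom_closed[OF assms(3)]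
        Pi_def)
qed

lemma rmod_hom_id: "right_module B M \<Longrightarrow> (\<lambda>x\<in>carrier M. x) \<in> rmod_hom B M M"
  by (rule rmod_hom_restrictI) simp_all

lemma rmod_hom_compose:
  assumes "right_module B X" "f \<in> rmod_hom B X Y" "g \<in> rmod_hom B Y Z"
  shows "compose (carrier X) g f \<in> rmod_hom B X Z"
  unfolding compose_def
  using assms(2,3)
  by (intro rmod_hom_restrictI[OF assms(1)])
    (auto simp: rmod_hom_closed[OF assms(2)] rmod_hom_closed[OF assms(3)]
      rmod_hom_add[OF assms(2)] rmod_hom_add[OF assms(3)]
      rmod_hom_ract[OF assms(2)] rmod_hom_ract[OF assms(3)])

lemma rmod_hom_zero_map:
  assumes "right_module B X" "right_module B Y"
  shows "(\<lambda>x\<in>carrier X. \<zero>\<^bsub>Y\<^esub>) \<in> rmod_hom B X Y"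
proof -
  interpret Y: right_module B Y by fact
  show ?thesis by (intro rmod_hom_restrictI[OF assms(1)]) (auto simp: Y.ract_zero_left)
qed

lemma rmod_hom_diff_map:
  assumes X: "right_module B X" and Y: "right_module B Y"
    and f: "f \<in> rmod_hom B X Y" and g: "g \<in> rmod_hom B X Y"
  shows "(\<lambda>x\<in>carrier X. f x \<ominus>\<^bsub>Y\<^esub> g x) \<in> rmod_hom B X Y"
proof -
  interpret Y: right_module B Y by fact
  show ?thesis
    using rmod_hom_closed[OF f] rmod_hom_closed[OF g]
    by (intro rmod_hom_restrictI[OF X])
      (auto simp: rmod_hom_add[OF f] rmod_hom_add[OF g] rmod_hom_ract[OF f] rmod_hom_ract[OF g]
        a_minus_def Y.ract_add_left Y.ract_minus_left Y.M.minus_add Y.M.a_ac)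
qed

lemma rmod_hom_sum_map:
  assumes X: "right_module B X" and Y: "right_module B Y"
    and f: "f \<in> rmod_hom B X Y" and g: "g \<in> rmod_hom B X Y"
  shows "(\<lambda>x\<in>carrier X. f x \<oplus>\<^bsub>Y\<^esub> g x) \<in> rmod_hom B X Y"
proof -
  interpret Y: right_module B Y by fact
  show ?thesis
    using rmod_hom_closed[OF f] rmod_hom_closed[OF g]
    by (intro rmod_hom_restrictI[OF X])
      (auto simp: rmod_hom_add[OF f] rmod_hom_add[OF g] rmod_hom_ract[OF f] rmod_hom_ract[OF g]
        Y.ract_add_left Y.M.a_ac)
qed

section \<open>Factoring through kernels and cokernels, lifting from projectives\<close>

lemma short_exact_zero:
  assumes "short_exact B K P X i q" "z \<in> carrier K"
  shows "q (i z) = \<zero>\<^bsub>X\<^esub>"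
  using assms by (auto simp: short_exact_def)

text \<open>The map \<open>i\<close> is a kernel of \<open>q\<close>: \<open>h\<close> takes its
  values in the image of \<open>i\<close>, and inverting \<open>i\<close> there is unambiguous.
  Injectivity of \<open>i\<close> also transfers additivity and linearity from \<open>h\<close> to
  the lift.\<close>

lemma short_exact_lift:
  assumes se: "short_exact B K P X i q" and K: "right_module B K" and Z: "right_module B Z"
    and h: "h \<in> rmod_hom B Z P" and ker: "\<And>z. z \<in> carrier Z \<Longrightarrow> q (h z) = \<zero>\<^bsub>X\<^esub>"
  shows "\<exists>d\<in>rmod_hom B Z K. \<forall>z\<in>carrier Z. i (d z) = h z"
proof -
  interpret K: right_module B K by fact
  interpret Z: right_module B Z by fact
  have i: "i \<in> rmod_hom B K P" and inj: "inj_on i (carrier K)"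
    and im: "i ` carrier K = {x \<in> carrier P. q x = \<zero>\<^bsub>X\<^esub>}"
    using se by (auto simp: short_exact_def)
  define d where "d z = inv_into (carrier K) i (h z)" for z
  have range: "h z \<in> i ` carrier K" if "z \<in> carrier Z" for z
    using that ker rmod_hom_closed[OF h] im by auto
  have d: "d z \<in> carrier K" and id: "i (d z) = h z" if "z \<in> carrier Z" for z
    using range[OF that] by (simp_all add: d_def inv_into_into f_inv_into_f)
  have "(\<lambda>z\<in>carrier Z. d z) \<in> rmod_hom B Z K"
  proof (rule rmod_hom_restrictI[OF Z])
    fix x y assume "x \<in> carrier Z" "y \<in> carrier Z"
    then show "d (x \<oplus>\<^bsub>Z\<^esub> y) = d x \<oplus>\<^bsub>K\<^esub> d y"
      by - (rule inj_onD[OF inj], auto simp: d id rmod_hom_add[OF i] rmod_hom_add[OF h])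
  next
    fix x b assume "x \<in> carrier Z" "b \<in> carrier B"
    then show "d (x \<star>\<^bsub>Z\<^esub> b) = d x \<star>\<^bsub>K\<^esub> b"
      by - (rule inj_onD[OF inj],
          auto simp: d id Z.ract_closed K.ract_closed rmod_hom_ract[OF i] rmod_hom_ract[OF h])
  qed (rule d)
  then show ?thesis using id by (intro bexI) auto
qed

text \<open>Two preimages of the same element under \<open>c\<close> differ by an element of the
  kernel, which \<open>h\<close> kills. Hence \<open>h\<close> is constant on the fibres of
  \<open>c\<close>, and \<open>inv_into\<close> may pick any preimage.\<close>

lemma surj_hom_factor:
  assumes A: "right_module B A" and C: "right_module B C" and Y: "right_module B Y"
    and c: "c \<in> rmod_hom B A C" and surj: "c ` carrier A = carrier C"
    and h: "h \<in> rmod_hom B A Y"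
    and ker: "\<And>x. x \<in> carrier A \<Longrightarrow> c x = \<zero>\<^bsub>C\<^esub> \<Longrightarrow> h x = \<zero>\<^bsub>Y\<^esub>"
  shows "\<exists>m\<in>rmod_hom B C Y. \<forall>x\<in>carrier A. m (c x) = h x"
proof -
  interpret A: right_module B A by fact
  interpret C: right_module B C by fact
  interpret Y: right_module B Y by fact
  have eq: "h x = h y" if "x \<in> carrier A" "y \<in> carrier A" "c x = c y" for x y
  proof -
    have "c (x \<ominus>\<^bsub>A\<^esub> y) = \<zero>\<^bsub>C\<^esub>"
      using that rmod_hom_closed[OF c] by (simp add: rmod_hom_diff[OF A C c] C.M.minus_eq_zero_iff)
    then have "h x \<ominus>\<^bsub>Y\<^esub> h y = \<zero>\<^bsub>Y\<^esub>"
      using ker[of "x \<ominus>\<^bsub>A\<^esub> y"] that by (simp add: rmod_hom_diff[OF A Y h])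
    then show ?thesis
      using that rmod_hom_closed[OF h] by (simp add: Y.M.minus_eq_zero_iff)
  qed
  define m where "m z = h (inv_into (carrier A) c z)" for z
  have m: "m (c x) = h x" if "x \<in> carrier A" for x
    unfolding m_def using that by (intro eq) (auto simp: inv_into_into f_inv_into_f)
  have "(\<lambda>z\<in>carrier C. m z) \<in> rmod_hom B C Y"
  proof (rule rmod_hom_restrictI[OF C])
    fix x assume "x \<in> carrier C"
    then show "m x \<in> carrier Y"
      using m rmod_hom_closed[OF h] by (auto simp flip: surj)
  next
    fix x y assume "x \<in> carrier C" "y \<in> carrier C"
    then obtain x' y' where "x' \<in> carrier A" "x = c x'" "y' \<in> carrier A" "y = c y'"
      by (auto simp flip: surj)
    then show "m (x \<oplus>\<^bsub>C\<^esub> y) = m x \<oplus>\<^bsub>Y\<^esub> m y"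
      using m[of "x' \<oplus>\<^bsub>A\<^esub> y'"] m by (simp add: rmod_hom_add[OF c] rmod_hom_add[OF h])
  next
    fix x b assume "x \<in> carrier C" and b: "b \<in> carrier B"
    then obtain x' where "x' \<in> carrier A" "x = c x'"
      by (auto simp flip: surj)
    then show "m (x \<star>\<^bsub>C\<^esub> b) = m x \<star>\<^bsub>Y\<^esub> b"
      using m[of "x' \<star>\<^bsub>A\<^esub> b"] m b
      by (simp add: A.ract_closed rmod_hom_ract[OF c] rmod_hom_ract[OF h])
  qed
  then show ?thesis
    using m rmod_hom_closed[OF c] by (intro bexI) auto
qed

lemma projective_lift:
  fixes P M N :: "('b, 'm) right_mod"
  assumes "projective B P" "right_module B M" "right_module B N"
    and "g \<in> rmod_hom B M N" "g ` carrier M = carrier N" "h \<in> rmod_hom B P N"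
  shows "\<exists>k\<in>rmod_hom B P M. \<forall>x\<in>carrier P. g (k x) = h x"
proof -
  have "\<exists>k\<in>rmod_hom B P M. compose (carrier P) g k = h"
    using assms unfolding projective_def by blast
  then show ?thesis by (auto simp: compose_def)
qed

section \<open>The stable category and the Heller operator\<close>

lemma fg_modules_right_module: "X \<in> fg_modules B \<Longrightarrow> right_module B X"
  by (simp add: fg_modules_def)

lemma stable_relI:
  fixes X Y Q :: "('b, 'm) right_mod"
  assumes "f \<in> rmod_hom B X Y" "g \<in> rmod_hom B X Y" "Q \<in> fg_modules B" "projective B Q"
    and "u \<in> rmod_hom B X Q" "v \<in> rmod_hom B Q Y"
    and "\<And>x. x \<in> carrier X \<Longrightarrow> f x \<ominus>\<^bsub>Y\<^esub> g x = v (u x)"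
  shows "(f, g) \<in> stable_rel B X Y"
  unfolding stable_rel_def using assms by blast

lemma stable_relE:
  fixes X Y :: "('b, 'm) right_mod"
  assumes "(f, g) \<in> stable_rel B X Y"
  obtains Q :: "('b, 'm) right_mod" and u v where "f \<in> rmod_hom B X Y" "g \<in> rmod_hom B X Y" "Q \<in> fg_modules B" "projective B Q"
    and "u \<in> rmod_hom B X Q" "v \<in> rmod_hom B Q Y"
    and "\<And>x. x \<in> carrier X \<Longrightarrow> f x \<ominus>\<^bsub>Y\<^esub> g x = v (u x)"
  using assms unfolding stable_rel_def by blast

text \<open>A preenvelope of \<open>X\<close> in the class of finitely generated projectives. The
  extension \<open>k\<close> need not be unique, so \<open>A\<close> does not depend functorially on
  \<open>X\<close>.\<close>

definition left_projective_approximation ::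
    "('b, 'k) ring_scheme \<Rightarrow> ('b, 'm) right_mod \<Rightarrow> ('b, 'm) right_mod \<Rightarrow> ('m \<Rightarrow> 'm) \<Rightarrow> bool" where
  "left_projective_approximation B X A \<iota> \<longleftrightarrow>
     A \<in> fg_modules B \<and> projective B A \<and> \<iota> \<in> rmod_hom B X A \<and>
     (\<forall>Q\<in>(fg_modules B :: ('b, 'm) right_mod set). projective B Q \<longrightarrow>
        (\<forall>h\<in>rmod_hom B X Q. \<exists>k\<in>rmod_hom B A Q. \<forall>x\<in>carrier X. k (\<iota> x) = h x))"

text \<open>Stated by exactness at \<open>A\<close> and surjectivity instead of as a concrete
  quotient, because a set of cosets would have the wrong element type.\<close>

definition cokernel ::
    "('b, 'k) ring_scheme \<Rightarrow> ('b, 'm) right_mod \<Rightarrow> ('b, 'm) right_mod \<Rightarrow> ('m \<Rightarrow> 'm) \<Rightarrow>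
     ('b, 'm) right_mod \<Rightarrow> ('m \<Rightarrow> 'm) \<Rightarrow> bool" where
  "cokernel B X A \<iota> C c \<longleftrightarrow>
     c \<in> rmod_hom B A C \<and> c ` carrier A = carrier C \<and> {y \<in> carrier A. c y = \<zero>\<^bsub>C\<^esub>} = \<iota> ` carrier X"

text \<open>Names one choice of the sequences that \<open>heller_operator\<close> hides behind an
  existential quantifier. In \<open>heller_hom\<close> the maps \<open>f'\<close> and
  \<open>f\<^sub>0\<close> stay existential, as only the stable class of \<open>f'\<close>
  matters.\<close>

locale heller =
  fixes B :: "('b, 'k) ring_scheme" and \<Omega> :: "('b, 'm) stable_endo"
    and P :: "('b, 'm) right_mod \<Rightarrow> ('b, 'm) right_mod" and i q
  assumes heller_obj: "\<And>X. X \<in> fg_modules B \<Longrightarrow>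
      on_obj \<Omega> X \<in> fg_modules B \<and> P X \<in> fg_modules B \<and> projective B (P X) \<and>
      short_exact B (on_obj \<Omega> X) (P X) X (i X) (q X)"
    and heller_hom: "\<And>X Y f. X \<in> fg_modules B \<Longrightarrow> Y \<in> fg_modules B \<Longrightarrow> f \<in> rmod_hom B X Y \<Longrightarrow>
      \<exists>f'\<in>rmod_hom B (on_obj \<Omega> X) (on_obj \<Omega> Y). \<exists>f\<^sub>0\<in>rmod_hom B (P X) (P Y).
        compose (carrier (on_obj \<Omega> X)) (i Y) f' = compose (carrier (on_obj \<Omega> X)) f\<^sub>0 (i X) \<and>
        compose (carrier (P X)) (q Y) f\<^sub>0 = compose (carrier (P X)) f (q X) \<and>
        on_hom \<Omega> X Y (stable_class B X Y f) = stable_class B (on_obj \<Omega> X) (on_obj \<Omega> Y) f'"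
begin

abbreviation FG where "FG \<equiv> fg_modules B :: ('b, 'm) right_mod set"
abbreviation syz where "syz X \<equiv> on_obj \<Omega> X"
abbreviation hom :: "('b, 'm) right_mod \<Rightarrow> ('b, 'm) right_mod \<Rightarrow> ('m \<Rightarrow> 'm) set"
  where "hom X Y \<equiv> rmod_hom B X Y"

text \<open>Any completion of \<open>f\<close> to a morphism of the chosen sequences, not just the
  one from which \<Omega> was formed. The equations are pointwise so that they can serve as rewrite
  rules.\<close>

definition sequence_map where
  "sequence_map X Y f f' f\<^sub>0 \<longleftrightarrow>
     f' \<in> hom (syz X) (syz Y) \<and> f\<^sub>0 \<in> hom (P X) (P Y) \<and>
     (\<forall>z\<in>carrier (syz X). i Y (f' z) = f\<^sub>0 (i X z)) \<and> (\<forall>z\<in>carrier (P X). q Y (f\<^sub>0 z) = f (q X z))"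

lemma
  assumes "X \<in> FG"
  shows syz_FG: "syz X \<in> FG" and P_FG: "P X \<in> FG" and P_projective: "projective B (P X)"
    and i_hom: "i X \<in> hom (syz X) (P X)" and q_hom: "q X \<in> hom (P X) X"
    and i_inj: "inj_on (i X) (carrier (syz X))" and q_surj: "q X ` carrier (P X) = carrier X"
    and q_i: "\<And>z. z \<in> carrier (syz X) \<Longrightarrow> q X (i X z) = \<zero>\<^bsub>X\<^esub>"
    and mod: "right_module B X" and syz_mod: "right_module B (syz X)" and P_mod: "right_module B (P X)"
  using heller_obj[OF assms] assms
  by (auto simp: short_exact_def fg_modules_right_module intro: short_exact_zero)

lemma i_lift:
  assumes "Y \<in> FG" "right_module B Z" "h \<in> hom Z (P Y)" "\<And>z. z \<in> carrier Z \<Longrightarrow> q Y (h z) = \<zero>\<^bsub>Y\<^esub>"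
  shows "\<exists>d\<in>hom Z (syz Y). \<forall>z\<in>carrier Z. i Y (d z) = h z"
  by (rule short_exact_lift[where X = Y and q = "q Y" and P = "P Y"])
    (use heller_obj[OF assms(1)] syz_mod[OF assms(1)] assms in auto)

lemma q_lift:
  assumes "Y \<in> FG" "projective B Q" "h \<in> hom Q Y"
  shows "\<exists>k\<in>hom Q (P Y). \<forall>x\<in>carrier Q. q Y (k x) = h x"
  using projective_lift[OF assms(2) P_mod[OF assms(1)] mod[OF assms(1)] q_hom[OF assms(1)] q_surj[OF assms(1)] assms(3)] .

text \<open>A map into \<open>Y\<close> that factors over some projective factors already over
  \<open>q Y\<close>, because its second factor lifts along this surjection. With the projective
  fixed as \<open>P Y\<close>, the witnesses of two relations can be added, and no direct sum of
  projectives has to be formed.\<close>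

lemma stable_rel_iff:
  assumes X: "X \<in> FG" and Y: "Y \<in> FG" and f: "f \<in> hom X Y" and g: "g \<in> hom X Y"
  shows "(f, g) \<in> stable_rel B X Y \<longleftrightarrow>
    (\<exists>k\<in>hom X (P Y). \<forall>x\<in>carrier X. f x = q Y (k x) \<oplus>\<^bsub>Y\<^esub> g x)"
proof -
  interpret Y: right_module B Y by (rule mod[OF Y])
  have minus_iff: "a \<ominus>\<^bsub>Y\<^esub> b = c \<longleftrightarrow> a = c \<oplus>\<^bsub>Y\<^esub> b"
    if "a \<in> carrier Y" "b \<in> carrier Y" "c \<in> carrier Y" for a b c
    using that by (metis Y.M.a_assoc Y.M.a_inv_closed Y.M.add.r_one a_minus_def Y.M.l_neg Y.M.r_neg)
  show ?thesis
  proof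
    assume "(f, g) \<in> stable_rel B X Y"
    then obtain Q u v where Q: "projective B Q" and u: "u \<in> hom X Q" and v: "v \<in> hom Q Y"
      and uv: "\<And>x. x \<in> carrier X \<Longrightarrow> f x \<ominus>\<^bsub>Y\<^esub> g x = v (u x)"
      by (auto elim: stable_relE)
    obtain k where k: "k \<in> hom Q (P Y)" "\<forall>x\<in>carrier Q. q Y (k x) = v x"
      using q_lift[OF Y Q v] by blast
    show "\<exists>k\<in>hom X (P Y). \<forall>x\<in>carrier X. f x = q Y (k x) \<oplus>\<^bsub>Y\<^esub> g x"
    proof (intro bexI[of _ "compose (carrier X) k u"] ballI)
      fix x assume x: "x \<in> carrier X"
      then show "f x = q Y (compose (carrier X) k u x) \<oplus>\<^bsub>Y\<^esub> g x"
        using uv[OF x] k(2) rmod_hom_closed[OF u x] rmod_hom_closed[OF f x] rmod_hom_closed[OF g x]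
          rmod_hom_closed[OF v, of "u x"]
        by (simp add: compose_eq minus_iff)
    qed (rule rmod_hom_compose[OF mod[OF X] u k(1)])
  next
    assume "\<exists>k\<in>hom X (P Y). \<forall>x\<in>carrier X. f x = q Y (k x) \<oplus>\<^bsub>Y\<^esub> g x"
    then obtain k where k: "k \<in> hom X (P Y)" "\<forall>x\<in>carrier X. f x = q Y (k x) \<oplus>\<^bsub>Y\<^esub> g x" by blast
    show "(f, g) \<in> stable_rel B X Y"
    proof (rule stable_relI[OF f g P_FG[OF Y] P_projective[OF Y] k(1) q_hom[OF Y]])
      fix x assume x: "x \<in> carrier X"
      show "f x \<ominus>\<^bsub>Y\<^esub> g x = q Y (k x)"
        using x k(2) rmod_hom_closed[OF f x] rmod_hom_closed[OF g x]
          rmod_hom_closed[OF q_hom[OF Y] rmod_hom_closed[OF k(1) x]]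
        by (subst minus_iff) auto
    qed
  qed
qed

lemma equiv_stable_rel:
  assumes X: "X \<in> FG" and Y: "Y \<in> FG"
  shows "equiv (hom X Y) (stable_rel B X Y)"
proof (rule equivI)
  interpret Y: right_module B Y by (rule mod[OF Y])
  interpret PY: right_module B "P Y" by (rule P_mod[OF Y])
  note iff = stable_rel_iff[OF X Y]
  note qY = q_hom[OF Y]
  show sub: "stable_rel B X Y \<subseteq> hom X Y \<times> hom X Y"
    by (auto simp: stable_rel_def)
  show "refl_on (hom X Y) (stable_rel B X Y)"
  proof (rule refl_onI)
    fix f assume f: "f \<in> hom X Y"
    show "(f, f) \<in> stable_rel B X Y"
      unfolding iff[OF f f]
      by (rule bexI[OF _ rmod_hom_zero_map[OF mod[OF X] P_mod[OF Y]]])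
        (auto simp: rmod_hom_zero[OF P_mod[OF Y] mod[OF Y] qY] rmod_hom_closed[OF f])
  qed
  show "sym (stable_rel B X Y)"
  proof (rule symI)
    fix f g assume fg: "(f, g) \<in> stable_rel B X Y"
    then have f: "f \<in> hom X Y" and g: "g \<in> hom X Y" by (auto elim: stable_relE)
    obtain k where k: "k \<in> hom X (P Y)" "\<forall>x\<in>carrier X. f x = q Y (k x) \<oplus>\<^bsub>Y\<^esub> g x"
      using fg iff[OF f g] by blast
    show "(g, f) \<in> stable_rel B X Y"
      unfolding iff[OF g f]
    proof (intro bexI ballI)
      \<comment> \<open>The witness is -k, written as the zero map minus \<open>k\<close> so that
        closure under differences applies.\<close>
      show "(\<lambda>x\<in>carrier X. (\<lambda>x\<in>carrier X. \<zero>\<^bsub>P Y\<^esub>) x \<ominus>\<^bsub>P Y\<^esub> k x) \<in> hom X (P Y)"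
        by (intro rmod_hom_diff_map rmod_hom_zero_map mod P_mod X Y k)
      fix x assume x: "x \<in> carrier X"
      have "q Y (\<zero>\<^bsub>P Y\<^esub> \<ominus>\<^bsub>P Y\<^esub> k x) = \<ominus>\<^bsub>Y\<^esub> q Y (k x)"
        using rmod_hom_closed[OF k(1) x] rmod_hom_closed[OF qY rmod_hom_closed[OF k(1) x]]
        by (simp add: rmod_hom_diff[OF P_mod[OF Y] mod[OF Y] qY]
            rmod_hom_zero[OF P_mod[OF Y] mod[OF Y] qY]) (simp add: a_minus_def)
      then show "g x = q Y ((\<lambda>x\<in>carrier X. (\<lambda>x\<in>carrier X. \<zero>\<^bsub>P Y\<^esub>) x \<ominus>\<^bsub>P Y\<^esub> k x) x) \<oplus>\<^bsub>Y\<^esub> f x"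
        using x k(2) rmod_hom_closed[OF g x] rmod_hom_closed[OF qY rmod_hom_closed[OF k(1) x]]
        by (simp add: Y.M.r_neg1)
    qed
  qed
  show "trans (stable_rel B X Y)"
  proof (rule transI)
    fix f g h assume fg: "(f, g) \<in> stable_rel B X Y" and gh: "(g, h) \<in> stable_rel B X Y"
    then have f: "f \<in> hom X Y" and g: "g \<in> hom X Y" and h: "h \<in> hom X Y"
      by (auto elim: stable_relE)
    obtain k where k: "k \<in> hom X (P Y)" "\<forall>x\<in>carrier X. f x = q Y (k x) \<oplus>\<^bsub>Y\<^esub> g x"
      using fg iff[OF f g] by blast
    obtain l where l: "l \<in> hom X (P Y)" "\<forall>x\<in>carrier X. g x = q Y (l x) \<oplus>\<^bsub>Y\<^esub> h x"
      using gh iff[OF g h] by blast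
    show "(f, h) \<in> stable_rel B X Y"
      unfolding iff[OF f h]
    proof (intro bexI ballI)
      show "(\<lambda>x\<in>carrier X. k x \<oplus>\<^bsub>P Y\<^esub> l x) \<in> hom X (P Y)"
        by (intro rmod_hom_sum_map mod P_mod X Y k l)
      fix x assume x: "x \<in> carrier X"
      then show "f x = q Y ((\<lambda>x\<in>carrier X. k x \<oplus>\<^bsub>P Y\<^esub> l x) x) \<oplus>\<^bsub>Y\<^esub> h x"
        using k(2) l(2) rmod_hom_closed[OF k(1) x] rmod_hom_closed[OF l(1) x] rmod_hom_closed[OF h x]
        by (simp add: rmod_hom_add[OF qY] rmod_hom_closed[OF qY] Y.M.a_assoc)
    qed
  qed
qed

lemma stable_rel_trans:
  "X \<in> FG \<Longrightarrow> Y \<in> FG \<Longrightarrow> (f, g) \<in> stable_rel B X Y \<Longrightarrow> (g, h) \<in> stable_rel B X Y \<Longrightarrow>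
    (f, h) \<in> stable_rel B X Y"
  using equiv_stable_rel[of X Y] by (auto simp: equiv_def elim: transE)

lemma stable_rel_refl:
  "X \<in> FG \<Longrightarrow> Y \<in> FG \<Longrightarrow> f \<in> hom X Y \<Longrightarrow> (f, f) \<in> stable_rel B X Y"
  using equiv_stable_rel[of X Y] by (auto simp: equiv_def dest: refl_onD)

lemma stable_rel_homD:
  "(f, g) \<in> stable_rel B X Y \<Longrightarrow> f \<in> hom X Y" "(f, g) \<in> stable_rel B X Y \<Longrightarrow> g \<in> hom X Y"
  by (auto elim: stable_relE)

lemma stable_class_eq_iff:
  "X \<in> FG \<Longrightarrow> Y \<in> FG \<Longrightarrow> f \<in> hom X Y \<Longrightarrow> g \<in> hom X Y \<Longrightarrow>
    stable_class B X Y f = stable_class B X Y g \<longleftrightarrow> (f, g) \<in> stable_rel B X Y"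
  unfolding stable_class_def by (rule eq_equiv_class_iff[OF equiv_stable_rel])

text \<open>One factor is replaced at a time. If f - f' = v u, then g f - g f' = (g v) u by
  additivity of \<open>g\<close>; if g - g' = v' u', then g f' - g' f' = v' (u' f').\<close>

lemma stable_rel_compose:
  assumes X: "X \<in> FG" and Y: "Y \<in> FG" and Z: "Z \<in> FG"
    and ff: "(f, f') \<in> stable_rel B X Y" and gg: "(g, g') \<in> stable_rel B Y Z"
  shows "(compose (carrier X) g f, compose (carrier X) g' f') \<in> stable_rel B X Z"
proof (rule stable_rel_trans[OF X Z])
  obtain Q u v where f: "f \<in> hom X Y" and f': "f' \<in> hom X Y" and Q: "Q \<in> FG" "projective B Q"
    and u: "u \<in> hom X Q" and v: "v \<in> hom Q Y"
    and uv: "\<And>x. x \<in> carrier X \<Longrightarrow> f x \<ominus>\<^bsub>Y\<^esub> f' x = v (u x)"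
    using ff by (auto elim: stable_relE)
  obtain Q' u' v' where g: "g \<in> hom Y Z" and g': "g' \<in> hom Y Z"
    and Q': "Q' \<in> FG" "projective B Q'"
    and u': "u' \<in> hom Y Q'" and v': "v' \<in> hom Q' Z"
    and uv': "\<And>x. x \<in> carrier Y \<Longrightarrow> g x \<ominus>\<^bsub>Z\<^esub> g' x = v' (u' x)"
    using gg by (auto elim: stable_relE)
  note comp = rmod_hom_compose[OF mod[OF X]]
  show "(compose (carrier X) g f, compose (carrier X) g f') \<in> stable_rel B X Z"
  proof (rule stable_relI[OF comp[OF f g] comp[OF f' g] Q u rmod_hom_compose[OF mod[OF Q(1)] v g]])
    fix x assume x: "x \<in> carrier X"
    then show "compose (carrier X) g f x \<ominus>\<^bsub>Z\<^esub> compose (carrier X) g f' x = compose (carrier Q) g v (u x)"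
      using uv[OF x] rmod_hom_closed[OF u x]
      by (simp add: compose_eq rmod_hom_closed[OF f] rmod_hom_closed[OF f']
          flip: rmod_hom_diff[OF mod[OF Y] mod[OF Z] g])
  qed
  show "(compose (carrier X) g f', compose (carrier X) g' f') \<in> stable_rel B X Z"
  proof (rule stable_relI[OF comp[OF f' g] comp[OF f' g'] Q' comp[OF f' u'] v'])
    fix x assume x: "x \<in> carrier X"
    then show "compose (carrier X) g f' x \<ominus>\<^bsub>Z\<^esub> compose (carrier X) g' f' x =
        v' (compose (carrier X) u' f' x)"
      using uv'[OF rmod_hom_closed[OF f' x]] by (simp add: compose_eq)
  qed
qed

section \<open>The stable category\<close>

abbreviation cls where "cls X Y f \<equiv> stable_class B X Y f"
abbreviation S where "S \<equiv> stable_mod B :: (('b, 'm) right_mod, ('m \<Rightarrow> 'm) set) cat"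

lemma Hom_S_cls: "f \<in> hom X Y \<Longrightarrow> cls X Y f \<in> Hom S X Y"
  by (auto simp: stable_mod_def stable_class_def intro: quotientI)

lemma Hom_S_E:
  assumes "\<alpha> \<in> Hom S X Y"
  obtains f where "f \<in> hom X Y" "\<alpha> = cls X Y f"
  using assms by (auto simp: stable_mod_def stable_class_def elim: quotientE)

text \<open>Congruence makes all members of the union over representatives equal, and reflexivity
  makes the index sets nonempty, so the union collapses to a single class.\<close>

lemma Comp_S:
  assumes X: "X \<in> FG" and Y: "Y \<in> FG" and Z: "Z \<in> FG" and f: "f \<in> hom X Y" and g: "g \<in> hom Y Z"
  shows "Comp S X Y Z (cls Y Z g) (cls X Y f) = cls X Z (compose (carrier X) g f)"
proof -
  have "cls X Z (compose (carrier X) g' f') = cls X Z (compose (carrier X) g f)"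
    if "g' \<in> cls Y Z g" "f' \<in> cls X Y f" for g' f'
  proof -
    have gg: "(g, g') \<in> stable_rel B Y Z" and ff: "(f, f') \<in> stable_rel B X Y"
      using that by (auto simp: stable_class_def)
    note cc = stable_rel_compose[OF X Y Z ff gg]
    show ?thesis
      using cc stable_class_eq_iff[OF X Z] stable_rel_homD[OF cc] by blast
  qed
  moreover have "g \<in> cls Y Z g" "f \<in> cls X Y f"
    using stable_rel_refl assms by (auto simp: stable_class_def)
  ultimately have "(\<Union>g'\<in>cls Y Z g. \<Union>f'\<in>cls X Y f. cls X Z (compose (carrier X) g' f')) =
      cls X Z (compose (carrier X) g f)"
    by blast
  then show ?thesis
    by (simp add: stable_mod_def)
qed

lemma Obj_S: "Obj S = FG"
  by (simp add: stable_mod_def)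

lemma Ident_S: "Ident S X = cls X X (\<lambda>x\<in>carrier X. x)"
  by (simp add: stable_mod_def)

lemma is_category_S: "is_category S"
  unfolding is_category_def Obj_S
proof (intro conjI ballI)
  fix X assume "X \<in> FG"
  then show "Ident S X \<in> Hom S X X"
    unfolding Ident_S by (intro Hom_S_cls rmod_hom_id mod)
next
  fix X Y \<alpha> assume X: "X \<in> FG" and Y: "Y \<in> FG" and "\<alpha> \<in> Hom S X Y"
  then obtain f where f: "f \<in> hom X Y" "\<alpha> = cls X Y f" by (elim Hom_S_E)
  have "compose (carrier X) f (\<lambda>x\<in>carrier X. x) = f"
    using X by (intro rmod_hom_eqI[OF rmod_hom_compose[OF mod rmod_hom_id[OF mod] f(1)] f(1)])
      (auto simp: compose_eq)
  then show "Comp S X X Y \<alpha> (Ident S X) = \<alpha>"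
    by (simp add: f Ident_S Comp_S X Y rmod_hom_id mod)
  have "compose (carrier X) (\<lambda>x\<in>carrier Y. x) f = f"
    using X Y by (intro rmod_hom_eqI[OF rmod_hom_compose[OF mod f(1) rmod_hom_id[OF mod]] f(1)])
      (auto simp: compose_eq rmod_hom_closed[OF f(1)])
  then show "Comp S X Y Y (Ident S Y) \<alpha> = \<alpha>"
    by (simp add: f Ident_S Comp_S X Y rmod_hom_id mod)
next
  fix X Y Z \<alpha> \<beta> assume o: "X \<in> FG" "Y \<in> FG" "Z \<in> FG" and "\<alpha> \<in> Hom S X Y" "\<beta> \<in> Hom S Y Z"
  then obtain f g where "f \<in> hom X Y" "\<alpha> = cls X Y f" "g \<in> hom Y Z" "\<beta> = cls Y Z g"
    by (elim Hom_S_E)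
  then show "Comp S X Y Z \<beta> \<alpha> \<in> Hom S X Z"
    using o by (simp add: Comp_S Hom_S_cls rmod_hom_compose mod)
next
  fix X Y Z W \<alpha> \<beta> \<gamma> assume o: "X \<in> FG" "Y \<in> FG" "Z \<in> FG" "W \<in> FG"
    and "\<alpha> \<in> Hom S X Y" "\<beta> \<in> Hom S Y Z" "\<gamma> \<in> Hom S Z W"
  then obtain f g h where f: "f \<in> hom X Y" "\<alpha> = cls X Y f" and g: "g \<in> hom Y Z" "\<beta> = cls Y Z g"
    and h: "h \<in> hom Z W" "\<gamma> = cls Z W h"
    by (elim Hom_S_E)
  have "compose (carrier X) (compose (carrier Y) h g) f = compose (carrier X) h (compose (carrier X) g f)"
    by (auto simp: compose_def rmod_hom_closed[OF f(1)])
  then show "Comp S X Y W (Comp S Y Z W \<gamma> \<beta>) \<alpha> = Comp S X Z W \<gamma> (Comp S X Y Z \<beta> \<alpha>)"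
    using o f g h by (simp add: Comp_S rmod_hom_compose mod)
qed

section \<open>Functoriality of the Heller operator\<close>

lemma on_hom_sequence_map:
  assumes X: "X \<in> FG" and Y: "Y \<in> FG" and f: "f \<in> hom X Y"
  obtains f' f\<^sub>0 where "sequence_map X Y f f' f\<^sub>0" "on_hom \<Omega> X Y (cls X Y f) = cls (syz X) (syz Y) f'"
proof -
  obtain f' f\<^sub>0 where f': "f' \<in> hom (syz X) (syz Y)" and f0: "f\<^sub>0 \<in> hom (P X) (P Y)"
    and i: "compose (carrier (syz X)) (i Y) f' = compose (carrier (syz X)) f\<^sub>0 (i X)"
    and q: "compose (carrier (P X)) (q Y) f\<^sub>0 = compose (carrier (P X)) f (q X)"
    and \<Omega>: "on_hom \<Omega> X Y (cls X Y f) = cls (syz X) (syz Y) f'"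
    using heller_hom[OF X Y f] by blast
  have "i Y (f' z) = f\<^sub>0 (i X z)" if "z \<in> carrier (syz X)" for z
    using fun_cong[OF i, of z] that by (simp add: compose_eq)
  moreover have "q Y (f\<^sub>0 z) = f (q X z)" if "z \<in> carrier (P X)" for z
    using fun_cong[OF q, of z] that by (simp add: compose_eq)
  ultimately have "sequence_map X Y f f' f\<^sub>0"
    using f' f0 by (simp add: sequence_map_def)
  then show ?thesis using \<Omega> that by blast
qed

text \<open>Let f - g = q k with k : X -> P Y. Then \<open>f\<^sub>0\<close> and k q +
  \<open>g\<^sub>0\<close> lift the same map P X -> Y, so their difference comes from some d : P X
  -> \<Omega> Y. On \<Omega> X the term k q vanishes, whence f' - g' = d i factors over the
  projective P X. The case f = g says that the completion does not matter.\<close>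

lemma sequence_map_stable:
  assumes X: "X \<in> FG" and Y: "Y \<in> FG" and fg: "(f, g) \<in> stable_rel B X Y"
    and f: "sequence_map X Y f f' f\<^sub>0" and g: "sequence_map X Y g g' g\<^sub>0"
  shows "(f', g') \<in> stable_rel B (syz X) (syz Y)"
proof -
  interpret Y: right_module B Y by (rule mod[OF Y])
  interpret PY: right_module B "P Y" by (rule P_mod[OF Y])
  interpret sY: right_module B "syz Y" by (rule syz_mod[OF Y])
  have fh: "f \<in> hom X Y" and gh: "g \<in> hom X Y" using stable_rel_homD[OF fg] .
  have f': "f' \<in> hom (syz X) (syz Y)" and f0: "f\<^sub>0 \<in> hom (P X) (P Y)"
    and g': "g' \<in> hom (syz X) (syz Y)" and g0: "g\<^sub>0 \<in> hom (P X) (P Y)"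
    using f g by (auto simp: sequence_map_def)
  obtain k where k: "k \<in> hom X (P Y)" "\<forall>x\<in>carrier X. f x = q Y (k x) \<oplus>\<^bsub>Y\<^esub> g x"
    using fg stable_rel_iff[OF X Y fh gh] by blast
  have kq: "compose (carrier (P X)) k (q X) \<in> hom (P X) (P Y)"
    by (rule rmod_hom_compose[OF P_mod[OF X] q_hom[OF X] k(1)])
  define w where "w = (\<lambda>z\<in>carrier (P X). compose (carrier (P X)) k (q X) z \<oplus>\<^bsub>P Y\<^esub> g\<^sub>0 z)"
  have w: "w \<in> hom (P X) (P Y)"
    unfolding w_def by (rule rmod_hom_sum_map[OF P_mod[OF X] P_mod[OF Y] kq g0])
  define h where "h = (\<lambda>z\<in>carrier (P X). f\<^sub>0 z \<ominus>\<^bsub>P Y\<^esub> w z)"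
  have h: "h \<in> hom (P X) (P Y)"
    unfolding h_def by (rule rmod_hom_diff_map[OF P_mod[OF X] P_mod[OF Y] f0 w])
  have "q Y (h z) = \<zero>\<^bsub>Y\<^esub>" if z: "z \<in> carrier (P X)" for z
  proof -
    have qz: "q X z \<in> carrier X" by (rule rmod_hom_closed[OF q_hom[OF X] z])
    have "q Y (w z) = f (q X z)"
      using z qz g k rmod_hom_closed[OF k(1) qz] rmod_hom_closed[OF g0 z]
      by (simp add: w_def compose_eq rmod_hom_add[OF q_hom[OF Y]] sequence_map_def)
    then show ?thesis
      using z f rmod_hom_closed[OF w z] rmod_hom_closed[OF f0 z] rmod_hom_closed[OF fh qz]
      by (simp add: h_def rmod_hom_diff[OF P_mod[OF Y] mod[OF Y] q_hom[OF Y]] sequence_map_def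
          Y.M.minus_eq_zero_iff)
  qed
  then obtain d where d: "d \<in> hom (P X) (syz Y)" "\<forall>z\<in>carrier (P X). i Y (d z) = h z"
    using i_lift[OF Y P_mod[OF X] h] by blast
  show ?thesis
  proof (rule stable_relI[OF f' g' P_FG[OF X] P_projective[OF X] i_hom[OF X] d(1)])
    fix z assume z: "z \<in> carrier (syz X)"
    have iz: "i X z \<in> carrier (P X)" by (rule rmod_hom_closed[OF i_hom[OF X] z])
    have "w (i X z) = g\<^sub>0 (i X z)"
      using z iz rmod_hom_closed[OF g0 iz]
      by (simp add: w_def compose_eq q_i[OF X z] rmod_hom_zero[OF mod[OF X] P_mod[OF Y] k(1)])
    then have "i Y (d (i X z)) = i Y (f' z) \<ominus>\<^bsub>P Y\<^esub> i Y (g' z)"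
      using d(2) iz z f g by (simp add: h_def sequence_map_def)
    also have "\<dots> = i Y (f' z \<ominus>\<^bsub>syz Y\<^esub> g' z)"
      using rmod_hom_closed[OF f' z] rmod_hom_closed[OF g' z]
      by (simp add: rmod_hom_diff[OF syz_mod[OF Y] P_mod[OF Y] i_hom[OF Y]])
    finally show "f' z \<ominus>\<^bsub>syz Y\<^esub> g' z = d (i X z)"
      using rmod_hom_closed[OF f' z] rmod_hom_closed[OF g' z] rmod_hom_closed[OF d(1) iz]
      by (metis inj_onD[OF i_inj[OF Y]] sY.M.minus_closed)
  qed
qed

text \<open>The specification of \<Omega> yields only some completion; independence of the
  completion allows \<Omega> to be computed from any convenient one.\<close>

lemma on_hom_eq:
  assumes X: "X \<in> FG" and Y: "Y \<in> FG" and f: "f \<in> hom X Y" and sm: "sequence_map X Y f f' f\<^sub>0"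
  shows "on_hom \<Omega> X Y (cls X Y f) = cls (syz X) (syz Y) f'"
proof -
  obtain f2 g2 where f2: "sequence_map X Y f f2 g2"
    "on_hom \<Omega> X Y (cls X Y f) = cls (syz X) (syz Y) f2"
    using on_hom_sequence_map[OF X Y f] .
  have rel: "(f2, f') \<in> stable_rel B (syz X) (syz Y)"
    by (rule sequence_map_stable[OF X Y stable_rel_refl[OF X Y f] f2(1) sm])
  show ?thesis
    using f2(2) rel stable_class_eq_iff[OF syz_FG[OF X] syz_FG[OF Y]] stable_rel_homD[OF rel] by simp
qed

text \<open>Identities and componentwise composites of completions are again completions, so
  \<open>on_hom_eq\<close> yields the functor laws.\<close>

lemma is_functor_heller: "is_functor S S \<Omega>"
  unfolding is_functor_def Obj_S
proof (intro conjI ballI)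
  fix X Y \<alpha> assume o: "X \<in> FG" "Y \<in> FG" and "\<alpha> \<in> Hom S X Y"
  then obtain f where f: "f \<in> hom X Y" "\<alpha> = cls X Y f" by (elim Hom_S_E)
  obtain f' f\<^sub>0 where "sequence_map X Y f f' f\<^sub>0" "on_hom \<Omega> X Y \<alpha> = cls (syz X) (syz Y) f'"
    using on_hom_sequence_map[OF o f(1)] f(2) by blast
  then show "on_hom \<Omega> X Y \<alpha> \<in> Hom S (syz X) (syz Y)"
    by (simp add: Hom_S_cls sequence_map_def)
next
  fix X assume X: "X \<in> FG"
  have "sequence_map X X (\<lambda>x\<in>carrier X. x) (\<lambda>x\<in>carrier (syz X). x) (\<lambda>x\<in>carrier (P X). x)"
    using X by (simp add: sequence_map_def rmod_hom_id syz_mod P_mod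
        rmod_hom_closed[OF i_hom] rmod_hom_closed[OF q_hom])
  then show "on_hom \<Omega> X X (Ident S X) = Ident S (syz X)"
    unfolding Ident_S by (intro on_hom_eq rmod_hom_id mod X)
next
  fix X Y Z \<alpha> \<beta> assume o: "X \<in> FG" "Y \<in> FG" "Z \<in> FG" and "\<alpha> \<in> Hom S X Y" "\<beta> \<in> Hom S Y Z"
  then obtain f g where f: "f \<in> hom X Y" "\<alpha> = cls X Y f" and g: "g \<in> hom Y Z" "\<beta> = cls Y Z g"
    by (elim Hom_S_E)
  obtain f' f\<^sub>0 where f': "sequence_map X Y f f' f\<^sub>0" "on_hom \<Omega> X Y \<alpha> = cls (syz X) (syz Y) f'"
    using on_hom_sequence_map[OF o(1,2) f(1)] f(2) by blast
  obtain g' g\<^sub>0 where g': "sequence_map Y Z g g' g\<^sub>0" "on_hom \<Omega> Y Z \<beta> = cls (syz Y) (syz Z) g'"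
    using on_hom_sequence_map[OF o(2,3) g(1)] g(2) by blast
  have fh: "f' \<in> hom (syz X) (syz Y)" "f\<^sub>0 \<in> hom (P X) (P Y)"
    and gh: "g' \<in> hom (syz Y) (syz Z)" "g\<^sub>0 \<in> hom (P Y) (P Z)"
    using f' g' by (auto simp: sequence_map_def)
  have "sequence_map X Z (compose (carrier X) g f) (compose (carrier (syz X)) g' f')
      (compose (carrier (P X)) g\<^sub>0 f\<^sub>0)"
    using f'(1) g'(1) o unfolding sequence_map_def
    by (auto simp: compose_eq rmod_hom_closed[OF fh(1)] rmod_hom_closed[OF fh(2)]
        rmod_hom_closed[OF i_hom] rmod_hom_closed[OF q_hom]
        intro!: rmod_hom_compose syz_mod P_mod)
  then show "on_hom \<Omega> X Z (Comp S X Y Z \<beta> \<alpha>) =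
      Comp S (syz X) (syz Y) (syz Z) (on_hom \<Omega> Y Z \<beta>) (on_hom \<Omega> X Y \<alpha>)"
    unfolding f'(2) g'(2) unfolding f(2) g(2)
    by (simp only: Comp_S o f(1) g(1) fh(1) gh(1) syz_FG on_hom_eq[OF o(1,3) rmod_hom_compose[OF mod[OF o(1)] f(1) g(1)]])
qed (rule syz_FG)

text \<open>The map \<open>\<eta>\<close> compares X -> A -> C with the sequence chosen for
  \<open>C\<close>. Injectivity and surjectivity are two chases of the same pattern: a map A -> P Y
  is corrected until it vanishes on the image of \<open>\<iota>\<close> or lands in the kernel of
  \<open>q Y\<close>.\<close>

lemma universal_arrow:
  assumes X: "X \<in> FG" and A: "left_projective_approximation B X A \<iota>"
    and C: "C \<in> FG" and c: "cokernel B X A \<iota> C c"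
  shows "\<exists>\<eta>\<in>hom X (syz C). \<forall>Y\<in>FG.
    bij_betw (\<lambda>u. Comp S X (syz C) (syz Y) (on_hom \<Omega> C Y u) (cls X (syz C) \<eta>)) (Hom S C Y) (Hom S X (syz Y))"
proof -
  have A_FG: "A \<in> FG" and A_proj: "projective B A" and \<iota>: "\<iota> \<in> hom X A"
    and extend: "\<And>Q h. Q \<in> FG \<Longrightarrow> projective B Q \<Longrightarrow> h \<in> hom X Q \<Longrightarrow>
      \<exists>k\<in>hom A Q. \<forall>x\<in>carrier X. k (\<iota> x) = h x"
    using A by (auto simp: left_projective_approximation_def)
  have ch: "c \<in> hom A C" and c_surj: "c ` carrier A = carrier C"
    and c_ker: "{y \<in> carrier A. c y = \<zero>\<^bsub>C\<^esub>} = \<iota> ` carrier X"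
    using c by (auto simp: cokernel_def)
  have c_kerE: "\<exists>x\<in>carrier X. y = \<iota> x" if "y \<in> carrier A" "c y = \<zero>\<^bsub>C\<^esub>" for y
    using equalityD1[OF c_ker] that by auto
  note mA = mod[OF A_FG] and mX = mod[OF X] and mC = mod[OF C]
  note \<iota>c = rmod_hom_closed[OF \<iota>]
  \<comment> \<open>Since \<open>A\<close> is projective, \<open>c\<close> lifts along
    \<open>q C\<close>. As \<open>c\<close> kills the image of \<open>\<iota>\<close>, the lift
    composed with \<open>\<iota>\<close> ends in \<Omega> C, which defines
    \<open>\<eta>\<close>.\<close>
  obtain l where l: "l \<in> hom A (P C)" and ql: "\<And>y. y \<in> carrier A \<Longrightarrow> q C (l y) = c y"
    using q_lift[OF C A_proj ch] by blast
  have "q C (compose (carrier X) l \<iota> x) = \<zero>\<^bsub>C\<^esub>" if "x \<in> carrier X" for x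
    using that ql[OF \<iota>c] c_ker by (auto simp: compose_eq)
  then obtain \<eta> where \<eta>: "\<eta> \<in> hom X (syz C)" and
    "\<forall>x\<in>carrier X. i C (\<eta> x) = compose (carrier X) l \<iota> x"
    using i_lift[OF C mX rmod_hom_compose[OF mX \<iota> l]] by blast
  then have i\<eta>: "i C (\<eta> x) = l (\<iota> x)" if "x \<in> carrier X" for x
    using that by (simp add: compose_eq)
  note \<eta>c = rmod_hom_closed[OF \<eta>]
  have inj: "(u, v) \<in> stable_rel B C Y"
    if Y: "Y \<in> FG" and u: "u \<in> hom C Y" and v: "v \<in> hom C Y"
      and su: "sequence_map C Y u u' u\<^sub>0" and sv: "sequence_map C Y v v' v\<^sub>0"
      and rel: "(compose (carrier X) u' \<eta>, compose (carrier X) v' \<eta>) \<in> stable_rel B X (syz Y)"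
    for Y u u' u\<^sub>0 v v' v\<^sub>0
  proof -
    interpret Y: right_module B Y by (rule mod[OF Y])
    interpret PY: right_module B "P Y" by (rule P_mod[OF Y])
    have u': "u' \<in> hom (syz C) (syz Y)" and u0: "u\<^sub>0 \<in> hom (P C) (P Y)"
      and v': "v' \<in> hom (syz C) (syz Y)" and v0: "v\<^sub>0 \<in> hom (P C) (P Y)"
      using su sv by (auto simp: sequence_map_def)
    obtain Q a b where Q: "Q \<in> FG" "projective B Q" and a: "a \<in> hom X Q" and b: "b \<in> hom Q (syz Y)"
      and ab: "\<And>x. x \<in> carrier X \<Longrightarrow>
        compose (carrier X) u' \<eta> x \<ominus>\<^bsub>syz Y\<^esub> compose (carrier X) v' \<eta> x = b (a x)"
      using rel by (auto elim: stable_relE)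
    obtain a' where a': "a' \<in> hom A Q" and a'\<iota>: "\<And>x. x \<in> carrier X \<Longrightarrow> a' (\<iota> x) = a x"
      using extend[OF Q a] by blast
    \<comment> \<open>On the image of \<open>\<iota>\<close> this map agrees with the difference of
      \<open>u\<^sub>0\<close> l and \<open>v\<^sub>0\<close> l, yet \<open>q Y\<close> annihilates
      it everywhere.\<close>
    define w where "w = compose (carrier A) (i Y) (compose (carrier A) b a')"
    have w: "w \<in> hom A (P Y)"
      unfolding w_def by (intro rmod_hom_compose[OF mA _ i_hom[OF Y]] rmod_hom_compose[OF mA a' b])
    have qw: "q Y (w y) = \<zero>\<^bsub>Y\<^esub>" if y: "y \<in> carrier A" for y
      using q_i[OF Y rmod_hom_closed[OF b rmod_hom_closed[OF a' y]]] y by (simp add: w_def compose_eq)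
    define d where "d = (\<lambda>y\<in>carrier A. compose (carrier A) u\<^sub>0 l y \<ominus>\<^bsub>P Y\<^esub> compose (carrier A) v\<^sub>0 l y)"
    have d: "d \<in> hom A (P Y)"
      unfolding d_def
      by (intro rmod_hom_diff_map mA P_mod Y rmod_hom_compose[OF mA l] u0 v0)
    \<comment> \<open>The map \<open>d\<close> lifts (u - v) c. Subtracting \<open>w\<close> makes
      it vanish on the kernel of \<open>c\<close> without changing its image under
      \<open>q Y\<close>, so it descends to a map C -> P Y over which u - v factors.\<close>
    define e where "e = (\<lambda>y\<in>carrier A. d y \<ominus>\<^bsub>P Y\<^esub> w y)"
    have e: "e \<in> hom A (P Y)"
      unfolding e_def by (rule rmod_hom_diff_map[OF mA P_mod[OF Y] d w])
    have "e y = \<zero>\<^bsub>P Y\<^esub>" if y: "y \<in> carrier A" "c y = \<zero>\<^bsub>C\<^esub>" for y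
    proof -
      obtain x where x: "x \<in> carrier X" "y = \<iota> x" using c_kerE[OF y] by blast
      have "d y = i Y (u' (\<eta> x)) \<ominus>\<^bsub>P Y\<^esub> i Y (v' (\<eta> x))"
        using x y su sv \<eta>c[OF x(1)] by (simp add: d_def compose_eq sequence_map_def i\<eta>)
      also have "\<dots> = i Y (b (a x))"
        using ab[OF x(1)] x rmod_hom_closed[OF u' \<eta>c[OF x(1)]] rmod_hom_closed[OF v' \<eta>c[OF x(1)]]
        by (simp add: compose_eq flip: rmod_hom_diff[OF syz_mod[OF Y] P_mod[OF Y] i_hom[OF Y]])
      also have "\<dots> = w y"
        using x y by (simp add: w_def compose_eq a'\<iota>)
      finally show ?thesis
        using y rmod_hom_closed[OF w y(1)] by (simp add: e_def PY.M.minus_eq_zero_iff)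
    qed
    then obtain m where m: "m \<in> hom C (P Y)" and me: "\<And>y. y \<in> carrier A \<Longrightarrow> m (c y) = e y"
      using surj_hom_factor[OF mA mC P_mod[OF Y] ch c_surj e] by blast
    show ?thesis
    proof (rule stable_relI[OF u v P_FG[OF Y] P_projective[OF Y] m q_hom[OF Y]])
      fix z assume "z \<in> carrier C"
      then obtain y where y: "y \<in> carrier A" "z = c y" by (auto simp flip: c_surj)
      have ly: "l y \<in> carrier (P C)" by (rule rmod_hom_closed[OF l y(1)])
      have qd: "q Y (d y) = u z \<ominus>\<^bsub>Y\<^esub> v z"
        using y ly su sv rmod_hom_closed[OF u0 ly] rmod_hom_closed[OF v0 ly]
        by (simp add: d_def compose_eq rmod_hom_diff[OF P_mod[OF Y] mod[OF Y] q_hom[OF Y]]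
            sequence_map_def ql)
      have "q Y (m z) = q Y (d y) \<ominus>\<^bsub>Y\<^esub> q Y (w y)"
        using y me rmod_hom_closed[OF w y(1)] rmod_hom_closed[OF d y(1)]
        by (simp add: e_def rmod_hom_diff[OF P_mod[OF Y] mod[OF Y] q_hom[OF Y]])
      also have "\<dots> = q Y (d y)"
        using rmod_hom_closed[OF q_hom[OF Y] rmod_hom_closed[OF d y(1)]]
        by (simp add: qw[OF y(1)]) (simp add: a_minus_def)
      finally show "u z \<ominus>\<^bsub>Y\<^esub> v z = q Y (m z)" by (simp add: qd)
    qed
  qed
  \<comment> \<open>The preimage \<open>u\<close> is induced by an extension \<open>w\<close> of i v
    to \<open>A\<close>, because q w kills the image of \<open>\<iota>\<close>. The claim covers
    every completion \<open>u'\<close>, since \<Omega> may be computed from any of them.\<close>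
  have surj: "\<exists>u\<in>hom C Y. \<forall>u' u\<^sub>0. sequence_map C Y u u' u\<^sub>0 \<longrightarrow>
      (compose (carrier X) u' \<eta>, v) \<in> stable_rel B X (syz Y)"
    if Y: "Y \<in> FG" and v: "v \<in> hom X (syz Y)" for Y v
  proof -
    interpret Y: right_module B Y by (rule mod[OF Y])
    interpret PY: right_module B "P Y" by (rule P_mod[OF Y])
    interpret sY: right_module B "syz Y" by (rule syz_mod[OF Y])
    obtain w where w: "w \<in> hom A (P Y)" and
      "\<forall>x\<in>carrier X. w (\<iota> x) = compose (carrier X) (i Y) v x"
      using extend[OF P_FG[OF Y] P_projective[OF Y] rmod_hom_compose[OF mX v i_hom[OF Y]]] by blast
    then have w\<iota>: "w (\<iota> x) = i Y (v x)" if "x \<in> carrier X" for x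
      using that by (simp add: compose_eq)
    have "compose (carrier A) (q Y) w y = \<zero>\<^bsub>Y\<^esub>" if cy: "y \<in> carrier A" "c y = \<zero>\<^bsub>C\<^esub>" for y
    proof -
      obtain x where x: "x \<in> carrier X" and y: "y = \<iota> x" using c_kerE[OF cy] by blast
      show ?thesis
        using \<iota>c[OF x] q_i[OF Y rmod_hom_closed[OF v x]] by (simp add: compose_eq y w\<iota>[OF x])
    qed
    then obtain u where u: "u \<in> hom C Y" and uc: "\<And>y. y \<in> carrier A \<Longrightarrow> u (c y) = q Y (w y)"
      using surj_hom_factor[OF mA mC mod[OF Y] ch c_surj rmod_hom_compose[OF mA w q_hom[OF Y]]]
      by (auto simp: compose_eq)
    have "(compose (carrier X) u' \<eta>, v) \<in> stable_rel B X (syz Y)" if su: "sequence_map C Y u u' u\<^sub>0"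
      for u' u\<^sub>0
    proof -
      have u': "u' \<in> hom (syz C) (syz Y)" and u0: "u\<^sub>0 \<in> hom (P C) (P Y)"
        using su by (auto simp: sequence_map_def)
      \<comment> \<open>Both terms lift u c along \<open>q Y\<close>, so their difference takes its
        values in \<Omega> Y. Its restriction along \<open>\<iota>\<close> is u' \<eta> - v, which
        thus factors over the projective \<open>A\<close>.\<close>
      define h where "h = (\<lambda>y\<in>carrier A. compose (carrier A) u\<^sub>0 l y \<ominus>\<^bsub>P Y\<^esub> w y)"
      have h: "h \<in> hom A (P Y)"
        unfolding h_def by (rule rmod_hom_diff_map[OF mA P_mod[OF Y] rmod_hom_compose[OF mA l u0] w])
      have "q Y (h y) = \<zero>\<^bsub>Y\<^esub>" if y: "y \<in> carrier A" for y
      proof -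
        have ly: "l y \<in> carrier (P C)" by (rule rmod_hom_closed[OF l y])
        then show ?thesis
          using y su rmod_hom_closed[OF u0 ly] rmod_hom_closed[OF w y]
            rmod_hom_closed[OF q_hom[OF Y] rmod_hom_closed[OF w y]]
          by (simp add: h_def compose_eq rmod_hom_diff[OF P_mod[OF Y] mod[OF Y] q_hom[OF Y]]
              sequence_map_def ql uc Y.M.minus_eq_zero_iff)
      qed
      then obtain d where d: "d \<in> hom A (syz Y)" and id: "\<And>y. y \<in> carrier A \<Longrightarrow> i Y (d y) = h y"
        using i_lift[OF Y mA h] by blast
      show ?thesis
      proof (rule stable_relI[OF rmod_hom_compose[OF mX \<eta> u'] v A_FG A_proj \<iota> d])
        fix x assume x: "x \<in> carrier X"
        have "i Y (d (\<iota> x)) = i Y (u' (\<eta> x)) \<ominus>\<^bsub>P Y\<^esub> i Y (v x)"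
          using x su \<iota>c[OF x] \<eta>c[OF x]
          by (simp add: id h_def compose_eq w\<iota> sequence_map_def i\<eta>)
        also have "\<dots> = i Y (u' (\<eta> x) \<ominus>\<^bsub>syz Y\<^esub> v x)"
          using rmod_hom_closed[OF u' \<eta>c[OF x]] rmod_hom_closed[OF v x]
          by (simp add: rmod_hom_diff[OF syz_mod[OF Y] P_mod[OF Y] i_hom[OF Y]])
        finally have "d (\<iota> x) = u' (\<eta> x) \<ominus>\<^bsub>syz Y\<^esub> v x"
          using rmod_hom_closed[OF u' \<eta>c[OF x]] rmod_hom_closed[OF v x]
            rmod_hom_closed[OF d \<iota>c[OF x]]
          by (metis inj_onD[OF i_inj[OF Y]] sY.M.minus_closed)
        then show "compose (carrier X) u' \<eta> x \<ominus>\<^bsub>syz Y\<^esub> v x = d (\<iota> x)"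
          using x by (simp add: compose_eq)
      qed
    qed
    then show ?thesis using u by blast
  qed
  define \<Phi> where "\<Phi> Y \<alpha> = Comp S X (syz C) (syz Y) (on_hom \<Omega> C Y \<alpha>) (cls X (syz C) \<eta>)" for Y \<alpha>
  have \<Phi>_cls: "\<Phi> Y (cls C Y u) = cls X (syz Y) (compose (carrier X) u' \<eta>)"
    if "Y \<in> FG" "u \<in> hom C Y" "sequence_map C Y u u' u\<^sub>0" for Y u u' u\<^sub>0
    using that C X \<eta> by (simp add: \<Phi>_def on_hom_eq Comp_S syz_FG sequence_map_def)
  have "bij_betw (\<Phi> Y) (Hom S C Y) (Hom S X (syz Y))" if Y: "Y \<in> FG" for Y
  proof (rule bij_betw_imageI)
    note sX = stable_class_eq_iff[OF X syz_FG[OF Y]]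
    show "inj_on (\<Phi> Y) (Hom S C Y)"
    proof (rule inj_onI)
      fix \<alpha> \<beta> assume "\<alpha> \<in> Hom S C Y" "\<beta> \<in> Hom S C Y" and eq: "\<Phi> Y \<alpha> = \<Phi> Y \<beta>"
      then obtain u v where u: "u \<in> hom C Y" "\<alpha> = cls C Y u" and v: "v \<in> hom C Y" "\<beta> = cls C Y v"
        by (elim Hom_S_E)
      obtain u' u\<^sub>0 where su: "sequence_map C Y u u' u\<^sub>0" using on_hom_sequence_map[OF C Y u(1)] .
      obtain v' v\<^sub>0 where sv: "sequence_map C Y v v' v\<^sub>0" using on_hom_sequence_map[OF C Y v(1)] .
      have "compose (carrier X) u' \<eta> \<in> hom X (syz Y)" "compose (carrier X) v' \<eta> \<in> hom X (syz Y)"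
        using su sv by (auto simp: sequence_map_def intro: rmod_hom_compose[OF mX \<eta>])
      then have "(compose (carrier X) u' \<eta>, compose (carrier X) v' \<eta>) \<in> stable_rel B X (syz Y)"
        using eq sX by (simp add: u(2) v(2) \<Phi>_cls[OF Y u(1) su] \<Phi>_cls[OF Y v(1) sv])
      then show "\<alpha> = \<beta>"
        using inj[OF Y u(1) v(1) su sv] stable_class_eq_iff[OF C Y u(1) v(1)] u(2) v(2) by simp
    qed
    show "\<Phi> Y ` Hom S C Y = Hom S X (syz Y)"
    proof (intro equalityI subsetI)
      fix \<alpha> assume "\<alpha> \<in> \<Phi> Y ` Hom S C Y"
      then obtain u where u: "u \<in> hom C Y" "\<alpha> = \<Phi> Y (cls C Y u)" by (auto elim: Hom_S_E)
      obtain u' u\<^sub>0 where su: "sequence_map C Y u u' u\<^sub>0" using on_hom_sequence_map[OF C Y u(1)] .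
      have "compose (carrier X) u' \<eta> \<in> hom X (syz Y)"
        using su by (auto simp: sequence_map_def intro: rmod_hom_compose[OF mX \<eta>])
      then show "\<alpha> \<in> Hom S X (syz Y)"
        by (simp add: u(2) \<Phi>_cls[OF Y u(1) su] Hom_S_cls)
    next
      fix \<alpha> assume "\<alpha> \<in> Hom S X (syz Y)"
      then obtain v where v: "v \<in> hom X (syz Y)" "\<alpha> = cls X (syz Y) v" by (elim Hom_S_E)
      obtain u where u: "u \<in> hom C Y" and uv: "\<And>u' u\<^sub>0. sequence_map C Y u u' u\<^sub>0 \<Longrightarrow>
          (compose (carrier X) u' \<eta>, v) \<in> stable_rel B X (syz Y)"
        using surj[OF Y v(1)] by blast
      obtain u' u\<^sub>0 where su: "sequence_map C Y u u' u\<^sub>0" using on_hom_sequence_map[OF C Y u(1)] .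
      have "\<alpha> = \<Phi> Y (cls C Y u)"
        using uv[OF su] sX[OF stable_rel_homD[OF uv[OF su]]]
        by (simp add: v(2) \<Phi>_cls[OF Y u(1) su])
      then show "\<alpha> \<in> \<Phi> Y ` Hom S C Y" using Hom_S_cls[OF u] by blast
    qed
  qed
  then show ?thesis using \<eta> unfolding \<Phi>_def[abs_def] by blast
qed

lemma has_left_adjoint_heller:
  assumes "\<And>X. X \<in> FG \<Longrightarrow> \<exists>A \<iota> C c. left_projective_approximation B X A \<iota> \<and> C \<in> FG \<and> cokernel B X A \<iota> C c"
  shows "has_left_adjoint S S \<Omega>"
proof -
  have "\<forall>X\<in>FG. \<exists>C \<eta>. C \<in> FG \<and> \<eta> \<in> hom X (syz C) \<and> (\<forall>Y\<in>FG.
    bij_betw (\<lambda>u. Comp S X (syz C) (syz Y) (on_hom \<Omega> C Y u) (cls X (syz C) \<eta>)) (Hom S C Y) (Hom S X (syz Y)))"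
    using assms universal_arrow by meson
  then obtain L \<eta> where L: "\<And>X. X \<in> FG \<Longrightarrow> L X \<in> FG" and \<eta>: "\<And>X. X \<in> FG \<Longrightarrow> \<eta> X \<in> hom X (syz (L X))"
    and bij: "\<And>X Y. X \<in> FG \<Longrightarrow> Y \<in> FG \<Longrightarrow>
      bij_betw (\<lambda>u. Comp S X (syz (L X)) (syz Y) (on_hom \<Omega> (L X) Y u) (cls X (syz (L X)) (\<eta> X)))
        (Hom S (L X) Y) (Hom S X (syz Y))"
    by metis
  show ?thesis
    using has_left_adjoint_universal_arrows[OF is_category_S is_category_S is_functor_heller,
        where L = L and \<eta> = "\<lambda>X. cls X (syz (L X)) (\<eta> X)"]
      L Hom_S_cls[OF \<eta>] bij by (simp add: Obj_S)
qed

end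

section \<open>Modules over a finite ring\<close>

lemma finite_fin_gen:
  assumes M: "right_module B M" and fin: "finite (carrier M)"
  shows "fin_gen B M"
proof -
  have "N = carrier M" if "right_submodule B M N" "carrier M \<subseteq> N" for N
    using that subgroup.subset[of N "add_monoid M"] by (auto simp: right_submodule_def)
  then show ?thesis unfolding fin_gen_def using fin by blast
qed

lemma right_submoduleI:
  assumes "right_module B M" and "N \<subseteq> carrier M" "\<zero>\<^bsub>M\<^esub> \<in> N"
    and "\<And>x y. x \<in> N \<Longrightarrow> y \<in> N \<Longrightarrow> x \<oplus>\<^bsub>M\<^esub> y \<in> N"
    and "\<And>x. x \<in> N \<Longrightarrow> \<ominus>\<^bsub>M\<^esub> x \<in> N"
    and "\<And>x b. x \<in> N \<Longrightarrow> b \<in> carrier B \<Longrightarrow> x \<star>\<^bsub>M\<^esub> b \<in> N"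
  shows "right_submodule B M N"
proof -
  interpret right_module B M by fact
  have "subgroup N (add_monoid M)"
    using assms by (intro M.add.subgroupI) (auto simp flip: a_inv_def)
  then show ?thesis using assms by (simp add: right_submodule_def)
qed

lemma rmod_hom_image_submodule:
  assumes M: "right_module B M" and N: "right_module B N" and h: "h \<in> rmod_hom B M N"
  shows "right_submodule B N (h ` carrier M)"
proof -
  interpret M: right_module B M by fact
  interpret N: right_module B N by fact
  interpret h: abelian_group_hom M N h by (rule rmod_hom_abelian_group_hom[OF assms])
  show ?thesis
  proof (rule right_submoduleI[OF N])
    show "\<zero>\<^bsub>N\<^esub> \<in> h ` carrier M"
      by (rule image_eqI[of _ _ "\<zero>\<^bsub>M\<^esub>"]) (simp_all add: h.hom_zero)
    show "x \<oplus>\<^bsub>N\<^esub> y \<in> h ` carrier M" if "x \<in> h ` carrier M" "y \<in> h ` carrier M" for x y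
      using that by (auto simp flip: rmod_hom_add[OF h])
    show "\<ominus>\<^bsub>N\<^esub> x \<in> h ` carrier M" if "x \<in> h ` carrier M" for x
      using that by (auto simp flip: h.hom_a_inv)
    show "x \<star>\<^bsub>N\<^esub> b \<in> h ` carrier M" if "x \<in> h ` carrier M" "b \<in> carrier B" for x b
      using that by (auto simp: M.ract_closed simp flip: rmod_hom_ract[OF h])
  qed (use rmod_hom_closed[OF h] in auto)
qed

section \<open>Free modules and their coordinates\<close>

definition free_module :: "('b, 'k) ring_scheme \<Rightarrow> 's set \<Rightarrow> ('b, 's \<Rightarrow> 'b) right_mod" where
  "free_module B S =
     \<lparr>carrier = S \<rightarrow>\<^sub>E carrier B, monoid.mult = undefined, one = undefined,
      zero = (\<lambda>s\<in>S. \<zero>\<^bsub>B\<^esub>), add = (\<lambda>x y. \<lambda>s\<in>S. x s \<oplus>\<^bsub>B\<^esub> y s), ract = (\<lambda>x b. \<lambda>s\<in>S. x s \<otimes>\<^bsub>B\<^esub> b)\<rparr>"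

lemma free_module_simps [simp]:
  "carrier (free_module B S) = S \<rightarrow>\<^sub>E carrier B"
  "\<zero>\<^bsub>free_module B S\<^esub> = (\<lambda>s\<in>S. \<zero>\<^bsub>B\<^esub>)"
  "x \<oplus>\<^bsub>free_module B S\<^esub> y = (\<lambda>s\<in>S. x s \<oplus>\<^bsub>B\<^esub> y s)"
  "x \<star>\<^bsub>free_module B S\<^esub> b = (\<lambda>s\<in>S. x s \<otimes>\<^bsub>B\<^esub> b)"
  by (simp_all add: free_module_def)

lemma right_module_free_module:
  assumes "ring B"
  shows "right_module B (free_module B S)"
proof -
  interpret B: ring B by fact
  have "abelian_group (free_module B S)"
  proof (rule abelian_groupI)
    fix x assume x: "x \<in> carrier (free_module B S)"
    show "\<exists>y\<in>carrier (free_module B S). y \<oplus>\<^bsub>free_module B S\<^esub> x = \<zero>\<^bsub>free_module B S\<^esub>"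
      by (rule bexI[of _ "\<lambda>s\<in>S. \<ominus>\<^bsub>B\<^esub> x s"]) (use x PiE_mem[of x S "\<lambda>_. carrier B"] in \<open>auto simp: B.l_neg intro!: restrict_ext\<close>)
  qed (auto simp: PiE_iff B.a_ac fun_eq_iff extensional_def)
  then show ?thesis
    by (intro right_module.intro right_module_axioms.intro assms)
      (auto simp: PiE_iff B.l_distr B.r_distr B.m_assoc fun_eq_iff extensional_def)
qed

definition free_lift ::
    "('b, 'k) ring_scheme \<Rightarrow> 's set \<Rightarrow> ('b, 'm) right_mod \<Rightarrow> ('s \<Rightarrow> 'm) \<Rightarrow> ('s \<Rightarrow> 'b) \<Rightarrow> 'm" where
  "free_lift B S M m = (\<lambda>c\<in>carrier (free_module B S). finsum M (\<lambda>s. m s \<star>\<^bsub>M\<^esub> c s) S)"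

definition unit_vector :: "('b, 'k) ring_scheme \<Rightarrow> 's set \<Rightarrow> 's \<Rightarrow> 's \<Rightarrow> 'b" where
  "unit_vector B S s = (\<lambda>t\<in>S. if t = s then \<one>\<^bsub>B\<^esub> else \<zero>\<^bsub>B\<^esub>)"

lemma unit_vector_closed: "ring B \<Longrightarrow> unit_vector B S s \<in> carrier (free_module B S)"
  by (auto simp: unit_vector_def ring.ring_simprules)

text \<open>For infinite \<open>S\<close> the sum \<open>finsum\<close> has the default value zero,
  and the zero map is linear too, so both cases are treated alike.\<close>

lemma free_lift_hom:
  assumes M: "right_module B M" and m: "m \<in> S \<rightarrow> carrier M"
  shows "free_lift B S M m \<in> rmod_hom B (free_module B S) M"
proof -
  interpret M: right_module B M by fact
  have cl: "(\<lambda>s. m s \<star>\<^bsub>M\<^esub> c s) \<in> S \<rightarrow> carrier M" if "c \<in> S \<rightarrow>\<^sub>E carrier B" for c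
    using that m by (auto intro!: M.ract_closed)
  show ?thesis
    unfolding free_lift_def
  proof (rule rmod_hom_restrictI[OF right_module_free_module])
    show "ring B" by (rule M.B.ring_axioms)
  next
    fix x assume "x \<in> carrier (free_module B S)"
    then show "finsum M (\<lambda>s. m s \<star>\<^bsub>M\<^esub> x s) S \<in> carrier M"
      using cl by (intro M.M.finsum_closed) simp
  next
    fix x y assume x: "x \<in> carrier (free_module B S)" and y: "y \<in> carrier (free_module B S)"
    have "finsum M (\<lambda>s. m s \<star>\<^bsub>M\<^esub> (x \<oplus>\<^bsub>free_module B S\<^esub> y) s) S =
        finsum M (\<lambda>s. m s \<star>\<^bsub>M\<^esub> x s \<oplus>\<^bsub>M\<^esub> m s \<star>\<^bsub>M\<^esub> y s) S"
      using x y PiE_mem[of x S "\<lambda>_. carrier B"] PiE_mem[of y S "\<lambda>_. carrier B"] Pi_mem[OF m]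
      by (intro M.M.finsum_cong') (auto simp: M.ract_add_right M.ract_closed)
    then show "finsum M (\<lambda>s. m s \<star>\<^bsub>M\<^esub> (x \<oplus>\<^bsub>free_module B S\<^esub> y) s) S =
        finsum M (\<lambda>s. m s \<star>\<^bsub>M\<^esub> x s) S \<oplus>\<^bsub>M\<^esub> finsum M (\<lambda>s. m s \<star>\<^bsub>M\<^esub> y s) S"
      using x y cl by (simp add: M.M.finsum_addf)
  next
    fix x b assume x: "x \<in> carrier (free_module B S)" and b: "b \<in> carrier B"
    have "finsum M (\<lambda>s. m s \<star>\<^bsub>M\<^esub> (x \<star>\<^bsub>free_module B S\<^esub> b) s) S =
        finsum M (\<lambda>s. (m s \<star>\<^bsub>M\<^esub> x s) \<star>\<^bsub>M\<^esub> b) S"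
      using x b PiE_mem[of x S "\<lambda>_. carrier B"] Pi_mem[OF m]
      by (intro M.M.finsum_cong') (auto simp: M.ract_mult M.ract_closed)
    then show "finsum M (\<lambda>s. m s \<star>\<^bsub>M\<^esub> (x \<star>\<^bsub>free_module B S\<^esub> b) s) S =
        finsum M (\<lambda>s. m s \<star>\<^bsub>M\<^esub> x s) S \<star>\<^bsub>M\<^esub> b"
      using x b cl by (simp add: M.ract_finsum)
  qed
qed

lemma free_lift_unit_vector:
  assumes M: "right_module B M" and S: "finite S" and m: "m \<in> S \<rightarrow> carrier M" and s: "s \<in> S"
  shows "free_lift B S M m (unit_vector B S s) = m s"
proof -
  interpret M: right_module B M by fact
  have "free_lift B S M m (unit_vector B S s) = finsum M (\<lambda>t. m t \<star>\<^bsub>M\<^esub> unit_vector B S s t) S"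
    using unit_vector_closed[OF M.B.ring_axioms, of S s] by (simp add: free_lift_def)
  also have "\<dots> = finsum M (\<lambda>t. if s = t then m t else \<zero>\<^bsub>M\<^esub>) S"
    using Pi_mem[OF m] s by (intro M.M.finsum_cong')
      (auto simp: unit_vector_def M.ract_one M.ract_zero_right)
  also have "\<dots> = m s"
    using m s S by (intro M.M.finsum_singleton)
  finally show ?thesis .
qed

lemma finsum_free_module:
  assumes B: "ring B" and f: "f \<in> A \<rightarrow> carrier (free_module B S)" and t: "t \<in> S"
  shows "finsum (free_module B S) f A t = finsum B (\<lambda>a. f a t) A"
proof -
  interpret B: ring B by fact
  interpret F: right_module B "free_module B S" by (rule right_module_free_module[OF B])
  show ?thesis
    using f
  proof (induction A rule: infinite_finite_induct)
    case (insert a A)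
    then have "(\<lambda>a. f a t) \<in> A \<rightarrow> carrier B" "f a t \<in> carrier B"
      using t by (auto simp: Pi_iff PiE_mem)
    then show ?case
      using insert t by (subst F.M.finsum_insert) (auto simp: B.finsum_insert)
  qed (use t in auto)
qed

lemma free_module_expansion:
  assumes B: "ring B" and S: "finite S" and c: "c \<in> carrier (free_module B S)"
  shows "free_lift B S (free_module B S) (unit_vector B S) c = c"
proof -
  interpret B: ring B by fact
  interpret F: right_module B "free_module B S" by (rule right_module_free_module[OF B])
  have uv: "unit_vector B S \<in> S \<rightarrow> carrier (free_module B S)"
    by (intro Pi_I unit_vector_closed[OF B])
  have cl: "(\<lambda>s. unit_vector B S s \<star>\<^bsub>free_module B S\<^esub> c s) \<in> S \<rightarrow> carrier (free_module B S)"
  proof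
    fix s assume "s \<in> S"
    then show "unit_vector B S s \<star>\<^bsub>free_module B S\<^esub> c s \<in> carrier (free_module B S)"
      using c by (intro F.ract_closed unit_vector_closed[OF B]) auto
  qed
  have "free_lift B S (free_module B S) (unit_vector B S) c t = c t" if t: "t \<in> S" for t
  proof -
    have "free_lift B S (free_module B S) (unit_vector B S) c t =
        finsum B (\<lambda>s. (unit_vector B S s \<star>\<^bsub>free_module B S\<^esub> c s) t) S"
      using c finsum_free_module[OF B cl t] by (simp add: free_lift_def)
    also have "\<dots> = finsum B (\<lambda>s. if t = s then c s else \<zero>\<^bsub>B\<^esub>) S"
      using c t by (intro B.finsum_cong') (auto simp: unit_vector_def PiE_iff)
    also have "\<dots> = c t"
      using c t S by (intro B.finsum_singleton) (auto simp: PiE_mem)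
    finally show ?thesis .
  qed
  then show ?thesis
    using c rmod_hom_closed[OF free_lift_hom[OF F.right_module_axioms uv] c]
    by (intro PiE_ext[of _ S "\<lambda>_. carrier B"]) auto
qed

text \<open>Expanding \<open>c\<close> in unit vectors reduces the equality of two maps out of a
  free module to their equality on the basis.\<close>

lemma free_module_hom_expansion:
  assumes M: "right_module B M" and S: "finite S" and h: "h \<in> rmod_hom B (free_module B S) M"
    and c: "c \<in> carrier (free_module B S)"
  shows "h c = free_lift B S M (\<lambda>s. h (unit_vector B S s)) c"
proof -
  interpret M: right_module B M by fact
  note B = M.B.ring_axioms
  interpret F: right_module B "free_module B S" by (rule right_module_free_module[OF B])
  note uv = unit_vector_closed[OF B, of S]
  have "h c = h (finsum (free_module B S) (\<lambda>s. unit_vector B S s \<star>\<^bsub>free_module B S\<^esub> c s) S)"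
    using free_module_expansion[OF B S c] c by (simp add: free_lift_def)
  also have "\<dots> = finsum M (\<lambda>s. h (unit_vector B S s \<star>\<^bsub>free_module B S\<^esub> c s)) S"
    using c by (intro rmod_hom_finsum[OF F.right_module_axioms M h] Pi_I F.ract_closed uv) auto
  also have "\<dots> = finsum M (\<lambda>s. h (unit_vector B S s) \<star>\<^bsub>M\<^esub> c s) S"
    using c rmod_hom_ract[OF h uv] rmod_hom_closed[OF h uv]
    by (intro M.M.finsum_cong') (auto simp del: free_module_simps(4) intro!: M.ract_closed)
  finally show ?thesis using c by (simp add: free_lift_def)
qed

text \<open>A finite generating set yields a map from a finite free module whose image is a
  submodule containing all generators, hence everything. Together with
  \<open>finite_fin_gen\<close>, the objects over a finite ring are exactly the finite
  modules.\<close>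

lemma finite_fg_module:
  assumes fin: "finite (carrier B)" and M: "M \<in> fg_modules B"
  shows "finite (carrier M)"
proof -
  interpret M: right_module B M using M by (rule fg_modules_right_module)
  note B = M.B.ring_axioms
  obtain G where G: "finite G" "G \<subseteq> carrier M"
    and gen: "\<And>N. right_submodule B M N \<Longrightarrow> G \<subseteq> N \<Longrightarrow> N = carrier M"
    using M by (auto simp: fg_modules_def fin_gen_def)
  let ?h = "free_lift B G M (\<lambda>g. g)"
  have id: "(\<lambda>g. g) \<in> G \<rightarrow> carrier M" using G by auto
  have "?h ` carrier (free_module B G) = carrier M"
  proof (rule gen)
    show "right_submodule B M (?h ` carrier (free_module B G))"
      by (rule rmod_hom_image_submodule[OF right_module_free_module[OF B] M.right_module_axioms
            free_lift_hom[OF M.right_module_axioms id]])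
    show "G \<subseteq> ?h ` carrier (free_module B G)"
    proof
      fix g assume "g \<in> G"
      then show "g \<in> ?h ` carrier (free_module B G)"
        using free_lift_unit_vector[OF M.right_module_axioms G(1) id, of g]
          unit_vector_closed[OF B, of G g] by (metis image_eqI)
    qed
  qed
  moreover have "finite (carrier (free_module B G))"
    using fin G by (simp add: finite_PiE)
  ultimately show ?thesis by (metis finite_imageI)
qed

text \<open>For \<open>r\<close> injective this transports \<open>M\<close> along \<open>r\<close>; for \<open>r\<close> with the cosets of a submodule as
  fibres it is a quotient of \<open>M\<close> whose elements are not sets, but have the desired type.\<close>

definition image_module :: "('b, 'n) right_mod \<Rightarrow> ('n \<Rightarrow> 'm) \<Rightarrow> ('b, 'm) right_mod" where
  "image_module M r =
     \<lparr>carrier = r ` carrier M, monoid.mult = undefined, one = undefined, zero = r \<zero>\<^bsub>M\<^esub>,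
      add = (\<lambda>u v. r (inv_into (carrier M) r u \<oplus>\<^bsub>M\<^esub> inv_into (carrier M) r v)),
      ract = (\<lambda>u b. r (inv_into (carrier M) r u \<star>\<^bsub>M\<^esub> b))\<rparr>"

text \<open>The two congruence hypotheses make the preimages picked by \<open>inv_into\<close>
  immaterial; then \<open>r\<close> respects both operations and the module axioms carry over along
  it.\<close>

lemma image_module:
  fixes M :: "('b, 'n) right_mod" and r :: "'n \<Rightarrow> 'm"
  assumes M: "right_module B M"
    and add: "\<And>x x' y y'. \<lbrakk>x \<in> carrier M; x' \<in> carrier M; y \<in> carrier M; y' \<in> carrier M;
      r x = r x'; r y = r y'\<rbrakk> \<Longrightarrow> r (x \<oplus>\<^bsub>M\<^esub> y) = r (x' \<oplus>\<^bsub>M\<^esub> y')"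
    and ract: "\<And>x x' b. \<lbrakk>x \<in> carrier M; x' \<in> carrier M; b \<in> carrier B; r x = r x'\<rbrakk> \<Longrightarrow>
      r (x \<star>\<^bsub>M\<^esub> b) = r (x' \<star>\<^bsub>M\<^esub> b)"
  shows "right_module B (image_module M r)"
    and "(\<lambda>x\<in>carrier M. r x) \<in> rmod_hom B M (image_module M r)"
proof -
  interpret M: right_module B M by fact
  let ?I = "image_module M r"
  have carrier: "carrier ?I = r ` carrier M" and zero: "\<zero>\<^bsub>?I\<^esub> = r \<zero>\<^bsub>M\<^esub>"
    by (simp_all add: image_module_def)
  have add': "r x \<oplus>\<^bsub>?I\<^esub> r y = r (x \<oplus>\<^bsub>M\<^esub> y)" if "x \<in> carrier M" "y \<in> carrier M" for x y
    using that by (auto simp: image_module_def inv_into_into f_inv_into_f intro!: add)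
  have ract': "r x \<star>\<^bsub>?I\<^esub> b = r (x \<star>\<^bsub>M\<^esub> b)" if "x \<in> carrier M" "b \<in> carrier B" for x b
    using that by (auto simp: image_module_def inv_into_into f_inv_into_f intro!: ract)
  have "abelian_group ?I"
  proof (rule abelian_groupI)
    fix u assume "u \<in> carrier ?I"
    then obtain x where x: "x \<in> carrier M" "u = r x" by (auto simp: carrier)
    then show "\<exists>v\<in>carrier ?I. v \<oplus>\<^bsub>?I\<^esub> u = \<zero>\<^bsub>?I\<^esub>"
      by (intro bexI[of _ "r (\<ominus>\<^bsub>M\<^esub> x)"]) (auto simp: add' zero carrier M.M.l_neg)
  qed (auto simp: carrier zero add' M.M.a_ac)
  then show I: "right_module B ?I"
    by (intro right_module.intro right_module_axioms.intro M.B.ring_axioms)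
      (auto simp: carrier add' ract' M.ract_closed M.ract_add_left M.ract_add_right M.ract_mult M.ract_one)
  show "(\<lambda>x\<in>carrier M. r x) \<in> rmod_hom B M ?I"
    by (rule rmod_hom_restrictI[OF M]) (auto simp: carrier add' ract')
qed

lemma image_module_carrier: "carrier (image_module M r) = r ` carrier M"
  by (simp add: image_module_def)

lemma image_module_zero: "\<zero>\<^bsub>image_module M r\<^esub> = r \<zero>\<^bsub>M\<^esub>"
  by (simp add: image_module_def)

section \<open>Realising finite constructions in the prescribed element type\<close>

lemma finite_fg_modulesI: "right_module B M \<Longrightarrow> finite (carrier M) \<Longrightarrow> M \<in> fg_modules B"
  by (simp add: fg_modules_def finite_fin_gen)

text \<open>An infinite type contains a set with as many elements as \<open>M\<close>, and a
  bijection onto it transports the module structure. The inverse homomorphism comes from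
  \<open>surj_hom_factor\<close>, where injectivity gives the kernel condition.\<close>

lemma finite_transport:
  fixes M :: "('b, 'n) right_mod"
  assumes M: "right_module B M" and fin: "finite (carrier M)" and inf: "infinite (UNIV :: 'm set)"
  obtains A :: "('b, 'm) right_mod" and \<phi> \<psi> where
    "A \<in> fg_modules B" "\<phi> \<in> rmod_hom B M A" "\<psi> \<in> rmod_hom B A M"
    "\<And>x. x \<in> carrier M \<Longrightarrow> \<psi> (\<phi> x) = x" "\<And>a. a \<in> carrier A \<Longrightarrow> \<phi> (\<psi> a) = a"
proof -
  obtain r :: "'n \<Rightarrow> 'm" where r: "inj_on r (carrier M)"
  proof -
    obtain T :: "'m set" where "finite T" "card T = card (carrier M)"
      using infinite_arbitrarily_large[OF inf] by blast
    then obtain r where "bij_betw r (carrier M) T"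
      using finite_same_card_bij[OF fin, of T] by auto
    then show ?thesis using that by (auto simp: bij_betw_def)
  qed
  define A where "A = image_module M r"
  define \<phi> where "\<phi> = (\<lambda>x\<in>carrier M. r x)"
  note r_eq = inj_onD[OF r]
  have A: "right_module B A" and \<phi>: "\<phi> \<in> rmod_hom B M A"
    using image_module[OF M, of r] by (auto simp: A_def \<phi>_def dest: r_eq)
  have surj: "\<phi> ` carrier M = carrier A"
    by (simp add: A_def \<phi>_def image_module_carrier)
  have inj: "inj_on \<phi> (carrier M)"
    using r by (simp add: \<phi>_def)
  have zero: "x = \<zero>\<^bsub>M\<^esub>" if "x \<in> carrier M" "\<phi> x = \<zero>\<^bsub>A\<^esub>" for x
  proof -
    interpret M: right_module B M by fact
    show ?thesis using that inj_onD[OF inj] rmod_hom_zero[OF M A \<phi>] by simp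
  qed
  obtain \<psi> where \<psi>: "\<psi> \<in> rmod_hom B A M" and "\<forall>x\<in>carrier M. \<psi> (\<phi> x) = (\<lambda>x\<in>carrier M. x) x"
    using surj_hom_factor[OF M A M \<phi> surj rmod_hom_id[OF M]] zero by auto
  then have "\<And>x. x \<in> carrier M \<Longrightarrow> \<psi> (\<phi> x) = x" by simp
  moreover from this have "\<And>a. a \<in> carrier A \<Longrightarrow> \<phi> (\<psi> a) = a" by (auto simp flip: surj)
  moreover have "A \<in> fg_modules B"
    by (rule finite_fg_modulesI[OF A]) (use fin in \<open>simp flip: surj\<close>)
  ultimately show ?thesis using that \<phi> \<psi> by blast
qed

text \<open>The maps \<open>\<phi>\<close> and \<open>\<psi>\<close> present \<open>A\<close> as a
  retract of a free module. A map out of \<open>A\<close> is pulled back along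
  \<open>\<phi>\<close>, lifted on unit vectors, and restricted along \<open>\<psi>\<close>.\<close>

lemma free_transport_projective:
  fixes A :: "('b, 'm) right_mod" and S :: "'s set"
  assumes A: "right_module B A" and S: "finite S"
    and \<phi>: "\<phi> \<in> rmod_hom B (free_module B S) A" and \<psi>: "\<psi> \<in> rmod_hom B A (free_module B S)"
    and \<phi>\<psi>: "\<And>a. a \<in> carrier A \<Longrightarrow> \<phi> (\<psi> a) = a"
  shows "projective B A"
  unfolding projective_def
proof (intro conjI allI impI, rule A)
  fix M N :: "('b, 'm) right_mod" and g h
  assume "right_module B M \<and> right_module B N \<and> g \<in> rmod_hom B M N \<and> g ` carrier M = carrier N \<and>
    h \<in> rmod_hom B A N"
  then have M: "right_module B M" and N: "right_module B N" and g: "g \<in> rmod_hom B M N"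
    and surj: "g ` carrier M = carrier N" and h: "h \<in> rmod_hom B A N"
    by auto
  interpret A: right_module B A by fact
  interpret M: right_module B M by fact
  interpret N: right_module B N by fact
  note B = A.B.ring_axioms
  note F = right_module_free_module[OF B, of S]
  let ?e = "unit_vector B S"
  have h\<phi>: "compose (carrier (free_module B S)) h \<phi> \<in> rmod_hom B (free_module B S) N"
    by (rule rmod_hom_compose[OF F \<phi> h])
  \<comment> \<open>For \<open>s\<close> outside \<open>S\<close> the unit vector is the zero
    vector, so this holds for all \<open>s\<close>, and preimages can be chosen without a side
    condition.\<close>
  have "h (\<phi> (?e s)) \<in> g ` carrier M" for s
    using surj rmod_hom_closed[OF h rmod_hom_closed[OF \<phi> unit_vector_closed[OF B]]] by simp
  then have "\<forall>s. \<exists>x. x \<in> carrier M \<and> g x = h (\<phi> (?e s))" by (auto simp: image_iff) (metis)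
  then obtain m where m: "\<And>s. m s \<in> carrier M" "\<And>s. g (m s) = h (\<phi> (?e s))" by metis
  let ?l = "free_lift B S M m"
  have l: "?l \<in> rmod_hom B (free_module B S) M"
    by (rule free_lift_hom[OF M]) (use m in auto)
  have gl: "compose (carrier (free_module B S)) g ?l \<in> rmod_hom B (free_module B S) N"
    by (rule rmod_hom_compose[OF F l g])
  have "g (?l (?e s)) = h (\<phi> (?e s))" if "s \<in> S" for s
    using free_lift_unit_vector[OF M S _ that, of m] m by auto
  moreover have "h (\<phi> (?e s)) \<in> carrier N" for s
    by (rule rmod_hom_closed[OF h rmod_hom_closed[OF \<phi> unit_vector_closed[OF B]]])
  ultimately have "free_lift B S N (\<lambda>s. g (?l (?e s))) c = free_lift B S N (\<lambda>s. h (\<phi> (?e s))) c"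
    if "c \<in> carrier (free_module B S)" for c
    using that PiE_mem[of c S "\<lambda>_. carrier B"]
    by (auto simp: free_lift_def N.ract_closed intro!: N.M.finsum_cong')
  then have eq: "g (?l c) = h (\<phi> c)" if "c \<in> carrier (free_module B S)" for c
    using free_module_hom_expansion[OF N S gl that] free_module_hom_expansion[OF N S h\<phi> that]
      that unit_vector_closed[OF B, of S]
    by (simp add: compose_eq del: free_module_simps)
  show "\<exists>k\<in>rmod_hom B A M. compose (carrier A) g k = h"
  proof
    show "compose (carrier A) ?l \<psi> \<in> rmod_hom B A M"
      by (rule rmod_hom_compose[OF A \<psi> l])
    then have "compose (carrier A) g (compose (carrier A) ?l \<psi>) \<in> rmod_hom B A N"
      by (rule rmod_hom_compose[OF A _ g])
    then show "compose (carrier A) g (compose (carrier A) ?l \<psi>) = h"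
      by (rule rmod_hom_eqI[OF _ h])
        (simp add: compose_eq eq[OF rmod_hom_closed[OF \<psi>]] \<phi>\<psi>)
  qed
qed

text \<open>The quotient by the image of \<open>\<iota>\<close> is realised inside the carrier of
  \<open>A\<close>: each coset is replaced by one chosen member, so the elements keep their type. It
  is finite along with \<open>A\<close>, hence finitely generated.\<close>

lemma cokernel_exists:
  fixes X A :: "('b, 'm) right_mod"
  assumes fin: "finite (carrier B)" and X: "X \<in> fg_modules B" and A: "A \<in> fg_modules B"
    and \<iota>: "\<iota> \<in> rmod_hom B X A"
  shows "\<exists>C c. C \<in> fg_modules B \<and> cokernel B X A \<iota> C c"
proof -
  interpret X: right_module B X using X by (rule fg_modules_right_module)
  interpret A: right_module B A using A by (rule fg_modules_right_module)
  note mX = X.right_module_axioms and mA = A.right_module_axioms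
  define N where "N = \<iota> ` carrier X"
  have sub: "right_submodule B A N"
    unfolding N_def by (rule rmod_hom_image_submodule[OF mX mA \<iota>])
  then interpret N: subgroup N "add_monoid A" by (simp add: right_submodule_def)
  have N_ract: "x \<star>\<^bsub>A\<^esub> b \<in> N" if "x \<in> N" "b \<in> carrier B" for x b
    using sub that by (simp add: right_submodule_def)
  have N_sub: "N \<subseteq> carrier A" using N.subset by simp
  have N_add: "x \<oplus>\<^bsub>A\<^esub> y \<in> N" if "x \<in> N" "y \<in> N" for x y
    using N.m_closed[OF that] by simp
  have N_zero: "\<zero>\<^bsub>A\<^esub> \<in> N" using N.one_closed by simp
  have N_inv: "\<ominus>\<^bsub>A\<^esub> x \<in> N" if "x \<in> N" for x
    using N.m_inv_closed[OF that] by (simp add: a_inv_def)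
  define rel where "rel x y \<longleftrightarrow> x \<ominus>\<^bsub>A\<^esub> y \<in> N" for x y
  have rel_refl: "rel x x" if "x \<in> carrier A" for x
    using that N_zero by (simp add: rel_def a_minus_def A.M.r_neg)
  have rel_sym: "rel y x" if "rel x y" "x \<in> carrier A" "y \<in> carrier A" for x y
    using N_inv[OF that(1)[unfolded rel_def]] that(2,3)
    by (simp add: rel_def a_minus_def A.M.minus_add A.M.a_comm)
  have rel_trans: "rel x z"
    if "rel x y" "rel y z" "x \<in> carrier A" "y \<in> carrier A" "z \<in> carrier A" for x y z
    using N_add[OF that(1)[unfolded rel_def] that(2)[unfolded rel_def]] that(3-)
    by (simp add: rel_def a_minus_def A.M.a_assoc A.M.r_neg1)
  \<comment> \<open>Congruent elements satisfy the same predicate under \<open>SOME\<close>, so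
    \<open>r\<close> is constant on cosets; and \<open>r x\<close> is congruent to \<open>x\<close>,
    so \<open>r\<close> separates them.\<close>
  define r where "r x = (SOME z. z \<in> carrier A \<and> rel x z)" for x
  have r: "r x \<in> carrier A \<and> rel x (r x)" if "x \<in> carrier A" for x
    unfolding r_def by (rule someI[of _ x]) (use that rel_refl in auto)
  have r_eq_iff: "r x = r y \<longleftrightarrow> rel x y" if "x \<in> carrier A" "y \<in> carrier A" for x y
  proof
    assume "r x = r y"
    then show "rel x y"
      using r that rel_sym rel_trans by metis
  next
    assume "rel x y"
    then have "(z \<in> carrier A \<and> rel x z) \<longleftrightarrow> (z \<in> carrier A \<and> rel y z)" for z
      using that rel_sym rel_trans by metis
    then show "r x = r y" by (simp add: r_def)
  qed
  define C where "C = image_module A r"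
  define c where "c = (\<lambda>x\<in>carrier A. r x)"
  have r_add: "r (x \<oplus>\<^bsub>A\<^esub> y) = r (x' \<oplus>\<^bsub>A\<^esub> y')"
    if c: "x \<in> carrier A" "x' \<in> carrier A" "y \<in> carrier A" "y' \<in> carrier A" and eq: "r x = r x'" "r y = r y'"
    for x x' y y'
  proof -
    have "(x \<ominus>\<^bsub>A\<^esub> x') \<oplus>\<^bsub>A\<^esub> (y \<ominus>\<^bsub>A\<^esub> y') \<in> N"
      using N_add eq c by (simp add: r_eq_iff rel_def)
    then have "rel (x \<oplus>\<^bsub>A\<^esub> y) (x' \<oplus>\<^bsub>A\<^esub> y')"
      using c by (simp add: rel_def a_minus_def A.M.minus_add A.M.a_ac)
    then show ?thesis using c by (simp add: r_eq_iff)
  qed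
  have r_ract: "r (x \<star>\<^bsub>A\<^esub> b) = r (x' \<star>\<^bsub>A\<^esub> b)"
    if c: "x \<in> carrier A" "x' \<in> carrier A" "b \<in> carrier B" and eq: "r x = r x'" for x x' b
  proof -
    have "(x \<ominus>\<^bsub>A\<^esub> x') \<star>\<^bsub>A\<^esub> b \<in> N"
      using N_ract eq c by (simp add: r_eq_iff rel_def)
    then have "rel (x \<star>\<^bsub>A\<^esub> b) (x' \<star>\<^bsub>A\<^esub> b)"
      using c by (simp add: rel_def a_minus_def A.ract_add_left A.ract_minus_left)
    then show ?thesis using c by (simp add: r_eq_iff A.ract_closed)
  qed
  have C: "right_module B C" and c: "c \<in> rmod_hom B A C"
    unfolding C_def c_def using image_module[OF mA r_add r_ract] by blast+
  have surj: "c ` carrier A = carrier C"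
    by (simp add: C_def c_def image_module_carrier)
  have "c y = \<zero>\<^bsub>C\<^esub> \<longleftrightarrow> y \<in> N" if "y \<in> carrier A" for y
    using that by (simp add: C_def c_def image_module_zero r_eq_iff rel_def a_minus_def A.M.minus_equality[of "\<zero>\<^bsub>A\<^esub>" "\<zero>\<^bsub>A\<^esub>"])
  then have "{y \<in> carrier A. c y = \<zero>\<^bsub>C\<^esub>} = \<iota> ` carrier X"
    using N_sub by (auto simp: N_def)
  moreover have "C \<in> fg_modules B"
    by (rule finite_fg_modulesI[OF C]) (use finite_fg_module[OF fin A] in \<open>simp flip: surj\<close>)
  ultimately show ?thesis using c surj by (auto simp: cokernel_def)
qed

text \<open>The approximation of \<open>X\<close> is the evaluation map into the free module on the finite set of all
  linear forms on \<open>X\<close>.  Every map from \<open>X\<close> to a projective module factors through it, since a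
  projective module has a dual basis.\<close>

lemma left_projective_approximation_exists:
  fixes X :: "('b, 'm) right_mod"
  assumes fin: "finite (carrier B)" and inf: "infinite (UNIV :: 'm set)" and X: "X \<in> fg_modules B"
  shows "\<exists>A \<iota>. left_projective_approximation B X A \<iota>"
proof -
  interpret X: right_module B X using X by (rule fg_modules_right_module)
  note mX = X.right_module_axioms and B = X.B.ring_axioms
  note F = right_module_free_module[OF B]
  \<comment> \<open>The dual of \<open>X\<close>, finite because \<open>X\<close> and
    \<open>B\<close> are. It is written out because \<open>B\<close> is a ring record and not a
    \<open>right_mod\<close>, as \<open>rmod_hom\<close> expects.\<close>
  define S where "S = {f \<in> carrier X \<rightarrow>\<^sub>E carrier B.
    (\<forall>x\<in>carrier X. \<forall>y\<in>carrier X. f (x \<oplus>\<^bsub>X\<^esub> y) = f x \<oplus>\<^bsub>B\<^esub> f y) \<and>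
    (\<forall>x\<in>carrier X. \<forall>b\<in>carrier B. f (x \<star>\<^bsub>X\<^esub> b) = f x \<otimes>\<^bsub>B\<^esub> b)}"
  have "finite (carrier X \<rightarrow>\<^sub>E carrier B)"
    using finite_fg_module[OF fin X] fin by (intro finite_PiE)
  then have S: "finite S" by (rule finite_subset[rotated]) (auto simp: S_def)
  have free_fin: "finite (carrier (free_module B T))" if "finite T" for T :: "'t set"
    using that fin by (simp add: finite_PiE)
  define ev where "ev = (\<lambda>x\<in>carrier X. \<lambda>f\<in>S. f x)"
  have ev: "ev \<in> rmod_hom B X (free_module B S)"
    unfolding ev_def by (rule rmod_hom_restrictI[OF mX]) (auto simp: S_def fun_eq_iff)
  obtain A :: "('b, 'm) right_mod" and \<phi> \<psi> where A: "A \<in> fg_modules B"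
    and \<phi>: "\<phi> \<in> rmod_hom B (free_module B S) A" and \<psi>: "\<psi> \<in> rmod_hom B A (free_module B S)"
    and \<psi>\<phi>: "\<And>x. x \<in> carrier (free_module B S) \<Longrightarrow> \<psi> (\<phi> x) = x"
    and \<phi>\<psi>: "\<And>a. a \<in> carrier A \<Longrightarrow> \<phi> (\<psi> a) = a"
    using finite_transport[OF F free_fin[OF S] inf] by metis
  note mA = fg_modules_right_module[OF A]
  define \<iota> where "\<iota> = compose (carrier X) \<phi> ev"
  have \<iota>: "\<iota> \<in> rmod_hom B X A"
    unfolding \<iota>_def by (rule rmod_hom_compose[OF mX ev \<phi>])
  have \<psi>\<iota>: "\<psi> (\<iota> x) = (\<lambda>f\<in>S. f x)" if "x \<in> carrier X" for x
    using that \<psi>\<phi>[OF rmod_hom_closed[OF ev that]] by (simp add: \<iota>_def compose_eq ev_def)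
  have "\<exists>k\<in>rmod_hom B A Q. \<forall>x\<in>carrier X. k (\<iota> x) = h x"
    if Q: "Q \<in> fg_modules B" "projective B Q" and h: "h \<in> rmod_hom B X Q"
    for Q :: "('b, 'm) right_mod" and h
  proof -
    \<comment> \<open>All elements of \<open>Q\<close> serve as generators, so that surjectivity of
      the free cover can be read off from unit vectors.\<close>
    let ?T = "carrier Q"
    have T: "finite ?T" by (rule finite_fg_module[OF fin Q(1)])
    have mQ: "right_module B Q" by (rule fg_modules_right_module[OF Q(1)])
    let ?p = "free_lift B ?T Q (\<lambda>t. t)"
    have p: "?p \<in> rmod_hom B (free_module B ?T) Q"
      by (rule free_lift_hom[OF mQ]) auto
    \<comment> \<open>Projectivity of \<open>Q\<close> only tests modules with elements in the given
      type, so the free cover must be copied there before it can be split.\<close>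
    obtain D :: "('b, 'm) right_mod" and \<alpha> \<beta> where D: "D \<in> fg_modules B"
      and \<alpha>: "\<alpha> \<in> rmod_hom B (free_module B ?T) D" and \<beta>: "\<beta> \<in> rmod_hom B D (free_module B ?T)"
      and \<beta>\<alpha>: "\<And>x. x \<in> carrier (free_module B ?T) \<Longrightarrow> \<beta> (\<alpha> x) = x"
      using finite_transport[OF F free_fin[OF T] inf] by metis
    note mD = fg_modules_right_module[OF D]
    define g where "g = compose (carrier D) ?p \<beta>"
    have g: "g \<in> rmod_hom B D Q"
      unfolding g_def by (rule rmod_hom_compose[OF mD \<beta> p])
    have "t \<in> g ` carrier D" if t: "t \<in> ?T" for t
    proof (rule image_eqI)
      let ?e = "unit_vector B ?T t"
      have e: "?e \<in> carrier (free_module B ?T)" by (rule unit_vector_closed[OF B])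
      show "\<alpha> ?e \<in> carrier D" by (rule rmod_hom_closed[OF \<alpha> e])
      then show "t = g (\<alpha> ?e)"
        using free_lift_unit_vector[OF mQ T _ t, of "\<lambda>t. t"] by (simp add: g_def compose_eq \<beta>\<alpha>[OF e])
    qed
    then have "g ` carrier D = carrier Q" using rmod_hom_closed[OF g] by auto
    then obtain s where s: "s \<in> rmod_hom B Q D" and gs': "\<forall>y\<in>carrier Q. g (s y) = (\<lambda>y\<in>carrier Q. y) y"
      using projective_lift[OF Q(2) mD mQ g _ rmod_hom_id[OF mQ]] by blast
    have gs: "?p (\<beta> (s y)) = y" if "y \<in> carrier Q" for y
      using that bspec[OF gs' that] rmod_hom_closed[OF s that] by (simp add: g_def compose_eq)
    \<comment> \<open>The coordinates of s h. Each of them is a linear form on \<open>X\<close>,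
      hence a member of \<open>S\<close>, so the evaluation map already records everything needed to
      recover \<open>h\<close>.\<close>
    define w where "w = compose (carrier X) \<beta> (compose (carrier X) s h)"
    have w: "w \<in> rmod_hom B X (free_module B ?T)"
      unfolding w_def by (intro rmod_hom_compose[OF mX _ \<beta>] rmod_hom_compose[OF mX h s])
    define f where "f t = (\<lambda>x\<in>carrier X. w x t)" for t
    have fS: "f t \<in> S" if t: "t \<in> ?T" for t
    proof -
      have "w x t \<in> carrier B" if "x \<in> carrier X" for x
        using rmod_hom_closed[OF w that] t by auto
      then show ?thesis
        using t rmod_hom_add[OF w] rmod_hom_ract[OF w] by (auto simp: f_def S_def X.ract_closed)
    qed
    \<comment> \<open>Reindexing along \<open>f\<close>: the coordinate at \<open>t\<close> is read
      off at the form \<open>f t\<close>, and several \<open>t\<close> may share a form. This turns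
      the evaluation vector of \<open>x\<close> into \<open>w x\<close>.\<close>
    define \<rho> where "\<rho> = (\<lambda>c\<in>carrier (free_module B S). \<lambda>t\<in>?T. c (f t))"
    have \<rho>: "\<rho> \<in> rmod_hom B (free_module B S) (free_module B ?T)"
      unfolding \<rho>_def by (rule rmod_hom_restrictI[OF F]) (use fS in \<open>auto simp: fun_eq_iff\<close>)
    define k where "k = compose (carrier A) ?p (compose (carrier A) \<rho> \<psi>)"
    have k: "k \<in> rmod_hom B A Q"
      unfolding k_def by (intro rmod_hom_compose[OF mA _ p] rmod_hom_compose[OF mA \<psi> \<rho>])
    have "k (\<iota> x) = h x" if x: "x \<in> carrier X" for x
    proof -
      have wx: "w x \<in> carrier (free_module B ?T)" by (rule rmod_hom_closed[OF w x])
      have "\<rho> (\<lambda>f\<in>S. f x) = (\<lambda>t\<in>?T. f t x)"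
        using rmod_hom_closed[OF ev x] x fS unfolding \<rho>_def ev_def by (auto simp: fun_eq_iff)
      also have "\<dots> = w x"
        using wx x by (auto simp: f_def fun_eq_iff extensional_def PiE_iff)
      finally have "k (\<iota> x) = ?p (w x)"
        using rmod_hom_closed[OF \<iota> x] by (simp add: k_def compose_eq \<psi>\<iota>[OF x])
      also have "\<dots> = h x"
        using gs[OF rmod_hom_closed[OF h x]] x by (simp add: w_def compose_eq)
      finally show ?thesis .
    qed
    then show ?thesis using k by blast
  qed
  moreover have "projective B A"
    by (rule free_transport_projective[OF mA S \<phi> \<psi>]) (rule \<phi>\<psi>)
  ultimately have "left_projective_approximation B X A \<iota>"
    using A \<iota> by (simp add: left_projective_approximation_def)
  then show ?thesis by blast
qed

lemma heller_operator_has_left_adjoint: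
  fixes B :: "('b, 'k) ring_scheme" and \<Omega> :: "('b, 'm) stable_endo"
  assumes "finite (carrier B)" and "infinite (UNIV :: 'm set)" and "heller_operator B \<Omega>"
  shows "has_left_adjoint (stable_mod B) (stable_mod B) \<Omega>"
proof -
  obtain P i q where "heller B \<Omega> P i q"
    using assms(3) unfolding heller_operator_def heller_def by metis
  then interpret heller B \<Omega> P i q .
  show ?thesis
  proof (rule has_left_adjoint_heller)
    fix X :: "('b, 'm) right_mod" assume X: "X \<in> fg_modules B"
    obtain A \<iota> where A: "left_projective_approximation B X A \<iota>"
      using left_projective_approximation_exists[OF assms(1,2) X] by blast
    then have "A \<in> fg_modules B" "\<iota> \<in> rmod_hom B X A"
      by (auto simp: left_projective_approximation_def)
    then show "\<exists>A \<iota> C c. left_projective_approximation B X A \<iota> \<and> C \<in> fg_modules B \<and> cokernel B X A \<iota> C c"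
      using A cokernel_exists[OF assms(1) X] by blast
  qed
qed

section \<open>Finiteness of the algebra\<close>

text \<open>Division with remainder by X^3: every residue class contains a polynomial with
  coefficients only in degrees below 3, and these coefficients come from a finite ring.\<close>

lemma finite_base_ring:
  assumes p: "p > 1"
  shows "finite (carrier (base_ring p))"
proof -
  define F where "F = residue_ring (int p)"
  define P where "P = UP F"
  define I where "I = ideal_X_cubed p"
  interpret F: residues "int p" F
    using p by unfold_locales (simp_all add: F_def)
  interpret UP_cring F P
    by unfold_locales (simp add: P_def)
  have P_eq: "poly_ring_Fp p = P"
    by (simp add: poly_ring_Fp_def P_def F_def)
  have X: "poly_X p [^]\<^bsub>P\<^esub> (3::nat) = up_ring.monom P \<one>\<^bsub>F\<^esub> 3"
    by (simp add: poly_X_def P_eq F_def[symmetric] monom_pow)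
  have X_closed: "up_ring.monom P \<one>\<^bsub>F\<^esub> 3 \<in> carrier P" by simp
  have I: "I = Idl\<^bsub>P\<^esub> {up_ring.monom P \<one>\<^bsub>F\<^esub> 3}"
    by (simp add: I_def ideal_X_cubed_def P_eq X)
  interpret I: ideal I P
    unfolding I by (rule P.genideal_ideal) (use X_closed in simp)
  define T where "T = {f. (\<forall>n. f n \<in> carrier F) \<and> (\<forall>n\<ge>3::nat. f n = \<zero>\<^bsub>F\<^esub>)}"
  have "finite (carrier F)" by (rule F.finite)
  then have "finite ((\<lambda>g n. if n < 3 then g n else \<zero>\<^bsub>F\<^esub>) ` ({..<3::nat} \<rightarrow>\<^sub>E carrier F))"
    by (intro finite_imageI finite_PiE) auto
  moreover have "T \<subseteq> (\<lambda>g n. if n < 3 then g n else \<zero>\<^bsub>F\<^esub>) ` ({..<3::nat} \<rightarrow>\<^sub>E carrier F)"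
  proof
    fix f assume "f \<in> T"
    then show "f \<in> (\<lambda>g n. if n < 3 then g n else \<zero>\<^bsub>F\<^esub>) ` ({..<3::nat} \<rightarrow>\<^sub>E carrier F)"
      by (intro image_eqI[of _ _ "restrict f {..<3}"]) (auto simp: T_def)
  qed
  ultimately have T_fin: "finite T" by (rule finite_subset[rotated])
  have "\<exists>t\<in>T. I +>\<^bsub>P\<^esub> f = I +>\<^bsub>P\<^esub> t" if f: "f \<in> carrier P" for f
  proof -
    have up: "carrier P = up F" by (simp add: P_def UP_def)
    have coeff: "coeff P g n = g n" if "g \<in> carrier P" for g n
      using that by (simp add: P_def UP_def)
    have fn: "f n \<in> carrier F" for n using f up by auto
    obtain b where b: "bound \<zero>\<^bsub>F\<^esub> b f" using f up F.bound_upD by blast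
    \<comment> \<open>As the divisor is a power of X, remainder and quotient are read off from the
      coefficients: \<open>t\<close> truncates \<open>f\<close> and \<open>g\<close> shifts it down
      by three.\<close>
    define t where "t n = (if n < 3 then f n else \<zero>\<^bsub>F\<^esub>)" for n :: nat
    define g where "g n = f (n + 3)" for n
    have t: "t \<in> carrier P"
      unfolding up using fn by (intro mem_upI exI[of _ 3]) (auto simp: t_def bound_def)
    have g: "g \<in> carrier P"
      unfolding up using fn b by (intro mem_upI exI[of _ b]) (auto simp: g_def bound_def)
    let ?m = "up_ring.monom P \<one>\<^bsub>F\<^esub> 3 \<otimes>\<^bsub>P\<^esub> g"
    have mI: "?m \<in> I"
      using I.I_r_closed[OF P.genideal_self'[OF X_closed, folded I] g] .
    \<comment> \<open>Below degree 3 every term of the convolution contains a vanishing coefficient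
      of the monomial.\<close>
    have m_low: "coeff P ?m n = \<zero>\<^bsub>F\<^esub>" if "n < 3" for n
      using that g by (auto intro!: F.add.finprod_one_eqI)
    have m_high: "coeff P ?m n = f n" if "n \<ge> 3" for n
      using that coeff_monom_mult[OF F.one_closed g, of 3 "n - 3"] fn[of n] coeff[OF g, of "n - 3"]
      by (simp add: g_def)
    have "f = ?m \<oplus>\<^bsub>P\<^esub> t"
    proof (rule up_eqI)
      fix n
      show "coeff P f n = coeff P (?m \<oplus>\<^bsub>P\<^esub> t) n"
        using t g fn coeff[OF f] coeff[OF t] m_low[of n] m_high[of n]
        by (cases "n < 3") (simp_all add: t_def del: coeff_mult)
    qed (use f t g in auto)
    then have "f \<in> I +>\<^bsub>P\<^esub> t"
      using mI by (auto simp: a_r_coset_def')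
    then have "I +>\<^bsub>P\<^esub> f = I +>\<^bsub>P\<^esub> t"
      using I.a_repr_independence'[OF _ t] by simp
    moreover have "t \<in> T" using fn by (auto simp: T_def t_def)
    ultimately show ?thesis by blast
  qed
  then have "carrier (base_ring p) \<subseteq> (\<lambda>t. I +>\<^bsub>P\<^esub> t) ` T"
    by (auto simp: base_ring_def P_eq I_def[symmetric] FactRing_def A_RCOSETS_def')
  then show ?thesis using T_fin finite_surj by blast
qed

text \<open>The only arrow ends at a vertex where no arrow starts, so paths have length at most
  one.\<close>

lemma finite_quiver_paths_ef: "finite (quiver_paths ef_quiver)"
proof -
  have UNIV_ef: "(UNIV :: ef_vertex set) = {Vertex_e, Vertex_f}"
    using ef_vertex.exhaust by auto
  have "p = [] \<or> p = [Arrow_a]" if "pre_digraph.awalk ef_quiver u p v" for u p v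
  proof -
    have "pre_digraph.cas ef_quiver u p v" using that by (simp add: pre_digraph.awalk_def)
    then show ?thesis
    proof (cases p)
      case (Cons a ps)
      then show ?thesis
        using \<open>pre_digraph.cas ef_quiver u p v\<close> ef_arrow.exhaust[of a]
        by (cases ps) (auto simp: pre_digraph.cas.simps ef_quiver_def)
    qed simp
  qed
  then have "quiver_paths ef_quiver \<subseteq> UNIV \<times> {[], [Arrow_a]} \<times> UNIV"
    by (auto simp: quiver_paths_def)
  moreover have "finite ((UNIV :: ef_vertex set) \<times> {[], [Arrow_a]} \<times> (UNIV :: ef_vertex set))"
    by (simp add: UNIV_ef)
  ultimately show ?thesis by (rule finite_subset)
qed

text \<open>Elements of the path algebra are coefficient functions from a finite set of paths to a
  finite ring, and a finite ring has only finitely many cosets of an ideal.\<close>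

lemma finite_algebra_B:
  assumes "p > 1"
  shows "finite (carrier (algebra_B p))"
proof -
  have "finite (quiver_paths ef_quiver \<rightarrow>\<^sub>E carrier (base_ring p))"
    using finite_base_ring[OF assms] finite_quiver_paths_ef by (intro finite_PiE)
  then have "finite (carrier (ef_path_algebra p))"
    by (rule finite_subset[rotated]) (auto simp: ef_path_algebra_def path_algebra_def)
  then show ?thesis
    by (simp add: algebra_B_def FactRing_def A_RCOSETS_def')
qed

theorem proposition9:
  fixes p :: nat
    and \<Omega> :: "(ef_path_coeffs set, 'm) stable_endo"
  assumes "prime p" and "p \<in> {2..997}"
    and "infinite (UNIV :: 'm set)"
    and "heller_operator (algebra_B p) \<Omega>"
  shows "has_left_adjoint (stable_mod (algebra_B p)) (stable_mod (algebra_B p)) \<Omega>"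
  using heller_operator_has_left_adjoint[OF finite_algebra_B[OF prime_gt_1_nat] assms(3,4)] assms(1) .

end
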